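(* There exists $\delta>0$ such that, for any of the three models (Poisson multigraph, exponential, uniform), with probability tending to $1$ as $n\to\infty$, $$w(T_1)+w(T_2)\ge m_2+\delta.$$
   Context: Exponential model: $K_n$ with i.i.d. exponential(1) edge costs; uniform model: $K_n$ with i.i.d. uniform $(0,1)$ edge costs; Poisson model: for each unordered pair of distinct vertices of $[n]$, infinitely many parallel edges with costs the points of an intensity-1 Poisson process, independent over pairs. $T_1$ is the minimum-cost spanning tree and $T_2$ is the minimum-cost spanning tree after deleting the edges of $T_1$ (with $w(T_2):=\infty$ if it does not exist); $w$ denotes total edge cost. $m_2$ is the minimum total cost of two edge-disjoint spanning trees (for $n\ge4$, so that such pairs exist). *)

theory Defs
  imports "HOL-Probability.Probability"
begin

text \<open>Multigraphs on vertex set {0..<n}: an edge set E of an arbitrary type,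
  an endpoint map ends (each edge e joins the two vertices fst (ends e) and snd (ends e)),
  and a cost function c.\<close>

definition vpairs :: "nat \<Rightarrow> (nat \<times> nat) set" where
  "vpairs n = {(i, j). i < j \<and> j < n}"

definition adj_rel :: "('e \<Rightarrow> nat \<times> nat) \<Rightarrow> 'e set \<Rightarrow> (nat \<times> nat) set" where
  "adj_rel ends F = {(a, b). \<exists>e\<in>F. ends e = (a, b) \<or> ends e = (b, a)}"

definition spanning_tree :: "nat \<Rightarrow> ('e \<Rightarrow> nat \<times> nat) \<Rightarrow> 'e set \<Rightarrow> 'e set \<Rightarrow> bool" where
  "spanning_tree n ends E F \<longleftrightarrow> F \<subseteq> E \<and> finite F \<and> card F = n - 1 \<and>
     (\<forall>u<n. \<forall>v<n. (u, v) \<in> (adj_rel ends F)\<^sup>*)"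

definition weight :: "('e \<Rightarrow> real) \<Rightarrow> 'e set \<Rightarrow> real" where
  "weight c F = (\<Sum>e\<in>F. c e)"

definition is_MST :: "nat \<Rightarrow> ('e \<Rightarrow> nat \<times> nat) \<Rightarrow> ('e \<Rightarrow> real) \<Rightarrow> 'e set \<Rightarrow> 'e set \<Rightarrow> bool" where
  "is_MST n ends c E T \<longleftrightarrow> spanning_tree n ends E T \<and>
     (\<forall>T'. spanning_tree n ends E T' \<longrightarrow> weight c T \<le> weight c T')"

text \<open>m_2: minimum total cost of two edge-disjoint spanning trees.\<close>
definition m2 :: "nat \<Rightarrow> ('e \<Rightarrow> nat \<times> nat) \<Rightarrow> ('e \<Rightarrow> real) \<Rightarrow> 'e set \<Rightarrow> real" where
  "m2 n ends c E = Inf {weight c A + weight c B | A B.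
      spanning_tree n ends E A \<and> spanning_tree n ends E B \<and> A \<inter> B = {}}"

text \<open>The event w(T_1) + w(T_2) >= m_2 + delta, where T_1 is the MST and T_2 the MST of
  E - T_1 (w(T_2) = infinity if no spanning tree of E - T_1 exists, in which case the
  event holds).  Quantifying over all T_2 is the same as using the infimum w(T_2).\<close>
definition good_event :: "nat \<Rightarrow> ('e \<Rightarrow> nat \<times> nat) \<Rightarrow> ('e \<Rightarrow> real) \<Rightarrow> 'e set \<Rightarrow> real \<Rightarrow> bool" where
  "good_event n ends c E \<delta> \<longleftrightarrow>
     (\<forall>T1. is_MST n ends c E T1 \<longrightarrow>
        (\<forall>T2. spanning_tree n ends (E - T1) T2 \<longrightarrow> weight c T1 + weight c T2 \<ge> m2 n ends c E + \<delta>))"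

definition exp1 :: "real measure" where
  "exp1 = density lborel (exponential_density 1)"

definition unif01 :: "real measure" where
  "unif01 = uniform_measure lborel {0<..<1}"

text \<open>Exponential and uniform models: edges of K_n are the pairs (i,j), i<j<n.\<close>
definition exp_model :: "nat \<Rightarrow> ((nat \<times> nat) \<Rightarrow> real) measure" where
  "exp_model n = PiM (vpairs n) (\<lambda>_. exp1)"

definition unif_model :: "nat \<Rightarrow> ((nat \<times> nat) \<Rightarrow> real) measure" where
  "unif_model n = PiM (vpairs n) (\<lambda>_. unif01)"

text \<open>Poisson model: edge (p,k) is the k-th (0-based) parallel edge on pair p; with iid
  Exp(1) inter-arrival times x (p,m), its cost is the (k+1)-st point of a rate-1 Poisson
  process on [0,\<infinity>), independent over pairs.\<close>
definition pois_model :: "nat \<Rightarrow> (((nat \<times> nat) \<times> nat) \<Rightarrow> real) measure" where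
  "pois_model n = PiM (vpairs n \<times> UNIV) (\<lambda>_. exp1)"

definition pois_cost :: "(((nat \<times> nat) \<times> nat) \<Rightarrow> real) \<Rightarrow> ((nat \<times> nat) \<times> nat) \<Rightarrow> real" where
  "pois_cost x e = (\<Sum>m\<le>snd e. x (fst e, m))"

end

theory Submission
  imports Defs "HOL-Real_Asymp.Real_Asymp"
begin

text \<open>
  Put \<open>r = 512 / n\<close>.  Call an edge cheap if its cost is at most \<open>5 r\<close>.  Let \<open>C\<close> be a set of
  vertices that is connected by edges of cost at most \<open>r\<close> and also by edges of cost in
  \<open>(r, 2 r]\<close>.  Consider vertices \<open>a, b\<close> outside \<open>C\<close> whose only cheap edges are \<open>ab\<close> and \<open>au\<close>
  (of cost at most \<open>r\<close>) and \<open>bv\<close>, \<open>bw\<close> (of cost between \<open>2 r\<close> and \<open>4 r\<close>), with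
  \<open>u, v, w \<in> C\<close>.  Then \<open>T\<^sub>1\<close> contains \<open>ab\<close> and \<open>au\<close> but neither \<open>bv\<close> nor \<open>bw\<close>; and \<open>T\<^sub>2\<close> does
  not contain both \<open>bv\<close> and \<open>bw\<close>, but has to connect \<open>a\<close> by an edge of cost more than \<open>5 r\<close>.
  Replacing \<open>au\<close> by the unused edge at \<open>b\<close> in \<open>T\<^sub>1\<close>, and the expensive edge at \<open>a\<close> by \<open>au\<close> in
  \<open>T\<^sub>2\<close>, saves at least \<open>r\<close>, and these exchanges can be made simultaneously for all such pairs.

  It remains to find linearly many pairs.  Among the first half of the vertices, a union bound
  shows that any two disjoint linear-sized sets are joined by edges of both kinds, so a set \<open>C\<close> of
  linear size exists.  Given the costs among the first half, the configurations with \<open>a, b\<close> in the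
  second half are cylinder events on the remaining coordinates, any two of them are either
  disjoint or almost independent, and the second moment method applies.
\<close>

section \<open>Connectivity and edge exchanges\<close>

definition joins :: "('e \<Rightarrow> nat \<times> nat) \<Rightarrow> 'e \<Rightarrow> nat \<Rightarrow> nat \<Rightarrow> bool" where
  "joins ends e x y \<longleftrightarrow> ends e = (x, y) \<or> ends e = (y, x)"

definition conn :: "('e \<Rightarrow> nat \<times> nat) \<Rightarrow> 'e set \<Rightarrow> nat \<Rightarrow> nat \<Rightarrow> bool" where
  "conn ends F x y \<longleftrightarrow> (x, y) \<in> (adj_rel ends F)\<^sup>*"

lemma adj_rel_iff: "(x, y) \<in> adj_rel ends F \<longleftrightarrow> (\<exists>e\<in>F. joins ends e x y)"
  by (auto simp: adj_rel_def joins_def)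

lemma joins_sym: "joins ends e x y \<longleftrightarrow> joins ends e y x"
  by (auto simp: joins_def)

lemma joins_unique:
  assumes "joins ends e x y" "joins ends e x' y'"
  shows "(x' = x \<and> y' = y) \<or> (x' = y \<and> y' = x)"
  using assms by (auto simp: joins_def)

lemma conn_refl [simp]: "conn ends F x x"
  by (simp add: conn_def)

lemma conn_trans [trans]: "conn ends F x y \<Longrightarrow> conn ends F y z \<Longrightarrow> conn ends F x z"
  by (auto simp: conn_def)

lemma conn_sym: "conn ends F x y \<Longrightarrow> conn ends F y x"
proof -
  have "sym (adj_rel ends F)"
    by (auto simp: sym_def adj_rel_def)
  then show "conn ends F x y \<Longrightarrow> conn ends F y x"
    unfolding conn_def using sym_rtrancl symD by metis
qed

lemma conn_edge: "e \<in> F \<Longrightarrow> joins ends e x y \<Longrightarrow> conn ends F x y"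
  unfolding conn_def by (intro r_into_rtrancl) (auto simp: adj_rel_iff)

text \<open>The vertex map \<open>h\<close> is there for contractions: an edge of \<open>F\<close>
  may collapse to a point or be replaced by a whole path. \<open>conn_lift\<close> is the case of
  the identity.\<close>

lemma conn_map:
  assumes "conn ends F x y"
    and "\<And>e p q. e \<in> F \<Longrightarrow> joins ends e p q \<Longrightarrow> conn ends' G (h p) (h q)"
  shows "conn ends' G (h x) (h y)"
  using assms(1) unfolding conn_def
proof (induction rule: rtrancl_induct)
  case base
  show ?case by simp
next
  case (step y z)
  then obtain e where "e \<in> F" "joins ends e y z"
    by (auto simp: adj_rel_iff)
  then have "conn ends' G (h y) (h z)"
    by (rule assms(2))
  with step.IH show ?case
    by (auto simp: conn_def)
qed

lemma conn_lift:
  assumes "conn ends F x y"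
    and "\<And>e p q. e \<in> F \<Longrightarrow> joins ends e p q \<Longrightarrow> conn ends' G p q"
  shows "conn ends' G x y"
  using conn_map[where h = "\<lambda>x. x"] assms by blast

lemma conn_mono: "conn ends F x y \<Longrightarrow> F \<subseteq> G \<Longrightarrow> conn ends G x y"
  by (erule conn_lift) (auto intro: conn_edge)

lemma conn_crossing:
  assumes "conn ends F x y" "x \<in> X" "y \<notin> X"
  obtains e s t where "e \<in> F" "joins ends e s t" "s \<in> X" "t \<notin> X"
proof -
  have "\<exists>e\<in>F. \<exists>s t. joins ends e s t \<and> s \<in> X \<and> t \<notin> X"
    using assms unfolding conn_def
  proof (induction rule: rtrancl_induct)
    case base
    then show ?case by simp
  next
    case (step y z)
    then show ?case
      by (cases "y \<in> X") (auto simp: adj_rel_iff)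
  qed
  then show ?thesis
    using that by blast
qed

text \<open>A walk that passes over \<open>f\<close> twice can be shortened, so a single passage
  suffices.\<close>

lemma conn_insert_split:
  assumes "conn ends (insert f P) x y"
  shows "conn ends P x y \<or> (\<exists>s t. joins ends f s t \<and> conn ends P x s \<and> conn ends P t y)"
  using assms unfolding conn_def[of ends "insert f P"]
proof (induction rule: rtrancl_induct)
  case base
  show ?case by simp
next
  case (step y z)
  from step.hyps(2) obtain e where e: "e \<in> insert f P" "joins ends e y z"
    unfolding adj_rel_iff by blast
  show ?case
  proof (cases "e \<in> P")
    case True
    then have yz: "conn ends P y z"
      using e(2) by (rule conn_edge)
    show ?thesis
      using step.IH conn_trans[OF _ yz] by (elim disjE) auto
  next
    case False
    then have f: "joins ends f y z"
      using e by auto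
    show ?thesis
      using step.IH
    proof (elim disjE exE conjE)
      assume "conn ends P x y"
      then show ?thesis
        using f by (intro disjI2 exI[of _ y] exI[of _ z]) simp
    next
      fix s t assume st: "joins ends f s t" "conn ends P x s" "conn ends P t y"
      then consider "s = y" "t = z" | "s = z" "t = y"
        using joins_unique[OF f st(1)] by auto
      then show ?thesis
        using st f by cases (auto intro: conn_refl)
    qed
  qed
qed

text \<open>The removed edge is taken on a minimal subset of \<open>T\<close> connecting \<open>x\<close> and \<open>y\<close>; the new
  edge then closes a cycle through it.\<close>
lemma exchange_across_cut:
  assumes "finite T" "conn ends T x y" "x \<in> X" "y \<notin> X" "joins ends e x y"
  obtains f s t where "f \<in> T" "joins ends f s t" "s \<in> X" "t \<notin> X"
    "\<And>p q. conn ends T p q \<Longrightarrow> conn ends (insert e (T - {f})) p q"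
proof -
  obtain P where P: "P \<subseteq> T" "conn ends P x y"
    and P_min: "\<And>P'. P' \<subseteq> T \<Longrightarrow> conn ends P' x y \<Longrightarrow> card P \<le> card P'"
    using ex_has_least_nat[of "\<lambda>P. P \<subseteq> T \<and> conn ends P x y" T card] assms(2) by auto
  obtain f s0 t0 where f: "f \<in> P" "joins ends f s0 t0" "s0 \<in> X" "t0 \<notin> X"
    using conn_crossing[OF P(2) assms(3,4)] by blast
  have "finite P"
    using P(1) assms(1) finite_subset by blast
  then have "card (P - {f}) < card P"
    using f(1) by (meson card_Diff1_less)
  then have "\<not> conn ends (P - {f}) x y"
    using P_min[of "P - {f}"] P(1) by fastforce
  moreover have "conn ends (insert f (P - {f})) x y"
    using P(2) f(1) by (simp add: insert_absorb)
  ultimately obtain s t where st: "joins ends f s t" "conn ends (P - {f}) x s" "conn ends (P - {f}) t y"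
    using conn_insert_split[of ends f "P - {f}" x y] by auto
  let ?G = "insert e (T - {f})"
  have sub: "P - {f} \<subseteq> ?G"
    using P(1) by auto
  have "conn ends ?G s x"
    using conn_mono[OF st(2) sub] by (rule conn_sym)
  also have "conn ends ?G x y"
    using assms(5) by (intro conn_edge[of e]) auto
  also have "conn ends ?G y t"
    using conn_mono[OF st(3) sub] by (rule conn_sym)
  finally have s_t: "conn ends ?G s t" .
  show ?thesis
  proof (rule that[OF _ f(2-4)])
    show "f \<in> T"
      using f(1) P(1) by auto
    fix p q assume "conn ends T p q"
    then show "conn ends ?G p q"
    proof (rule conn_lift)
      fix g p q assume g: "g \<in> T" "joins ends g p q"
      show "conn ends ?G p q"
      proof (cases "g = f")
        case True
        then show ?thesis
          using joins_unique[OF st(1), of p q] g(2) s_t conn_sym by blast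
      next
        case False
        then show ?thesis
          using g by (intro conn_edge[of g]) auto
      qed
    qed
  qed
qed

text \<open>Every vertex other than the root is assigned an edge towards a vertex at smaller distance
  from the root; this assignment is injective.\<close>
lemma card_connecting_ge:
  assumes "finite F" and conn: "\<And>x. x < n \<Longrightarrow> conn ends F 0 x"
  shows "n - 1 \<le> card F"
proof -
  let ?R = "adj_rel ends F"
  define d where "d x = (LEAST k. (0, x) \<in> ?R ^^ k)" for x
  have d: "(0, x) \<in> ?R ^^ d x" if "conn ends F 0 x" for x
    using that unfolding d_def conn_def by (meson LeastI_ex rtrancl_imp_relpow)
  have "\<exists>e\<in>F. \<exists>y. joins ends e x y \<and> d y < d x" if "x \<in> {1..<n}" for x
  proof -
    have x: "(0, x) \<in> ?R ^^ d x" and "x \<noteq> 0"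
      using d conn that by auto
    then obtain k where k: "d x = Suc k"
      by (cases "d x") auto
    then obtain y where y: "(0, y) \<in> ?R ^^ k" "(y, x) \<in> ?R"
      using x by auto
    have "d y \<le> k"
      unfolding d_def using y(1) by (rule Least_le)
    then show ?thesis
      using y(2) k by (auto simp: adj_rel_iff joins_sym intro!: exI[of _ y])
  qed
  then obtain p where p: "\<And>x. x \<in> {1..<n} \<Longrightarrow> p x \<in> F \<and> (\<exists>y. joins ends (p x) x y \<and> d y < d x)"
    by metis
  have "inj_on p {1..<n}"
  proof (rule inj_onI)
    fix x x' assume x: "x \<in> {1..<n}" "x' \<in> {1..<n}" "p x = p x'"
    then obtain y y' where "joins ends (p x) x y" "d y < d x" "joins ends (p x) x' y'" "d y' < d x'"
      using p by metis
    then show "x = x'"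
      using joins_unique by (metis less_asym)
  qed
  then have "card {1..<n} \<le> card F"
    by (rule card_inj_on_le) (use p assms(1) in auto)
  then show ?thesis
    by simp
qed

section \<open>Spanning trees and the cut and cycle properties of minimum spanning trees\<close>

lemma spanning_tree_iff_conn:
  "spanning_tree n ends E F \<longleftrightarrow> F \<subseteq> E \<and> finite F \<and> card F = n - 1 \<and> (\<forall>u<n. \<forall>v<n. conn ends F u v)"
  by (simp add: spanning_tree_def conn_def)

lemma spanning_tree_conn: "spanning_tree n ends E T \<Longrightarrow> x < n \<Longrightarrow> y < n \<Longrightarrow> conn ends T x y"
  by (simp add: spanning_tree_iff_conn)

lemma spanning_tree_finite: "spanning_tree n ends E T \<Longrightarrow> finite T"
  by (simp add: spanning_tree_iff_conn)

lemma spanning_tree_subset: "spanning_tree n ends E T \<Longrightarrow> T \<subseteq> E"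
  by (simp add: spanning_tree_iff_conn)

lemma spanning_tree_swap:
  assumes T: "spanning_tree n ends E T" and "f \<in> T" "e \<in> E" "e \<notin> T"
    and "\<And>p q. conn ends T p q \<Longrightarrow> conn ends (insert e (T - {f})) p q"
  shows "spanning_tree n ends E (insert e (T - {f}))"
    and "weight c (insert e (T - {f})) = weight c T - c f + c e"
proof -
  have fin: "finite T"
    using T by (rule spanning_tree_finite)
  have "card (insert e (T - {f})) = card T"
    using fin assms(2,4) card_Suc_Diff1[of T f] by simp
  then show "spanning_tree n ends E (insert e (T - {f}))"
    using T assms(3,5) unfolding spanning_tree_iff_conn by auto
  show "weight c (insert e (T - {f})) = weight c T - c f + c e"
    using fin assms(2,4) by (simp add: weight_def sum_diff1)
qed

lemma is_MST_spanning_tree: "is_MST n ends c E T \<Longrightarrow> spanning_tree n ends E T"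
  by (simp add: is_MST_def)

lemma is_MST_le: "is_MST n ends c E T \<Longrightarrow> spanning_tree n ends E T' \<Longrightarrow> weight c T \<le> weight c T'"
  by (simp add: is_MST_def)

text \<open>Cycle property. Deleting \<open>e\<close> splits \<open>T\<close> into two sides; a
  bypass would have to change sides along some \<open>f\<close> cheaper than \<open>e\<close>, and
  swapping \<open>e\<close> for \<open>f\<close> would give a lighter tree.\<close>

lemma MST_edge_not_bypassed:
  assumes T: "is_MST n ends c E T" and e: "e \<in> T" "joins ends e x y" and "x < n" "y < n"
    and range: "\<And>f p q. f \<in> E \<Longrightarrow> joins ends f p q \<Longrightarrow> p < n \<and> q < n"
  shows "\<not> conn ends (T - {e} \<union> {f \<in> E. c f < c e}) x y"
proof
  assume bypass: "conn ends (T - {e} \<union> {f \<in> E. c f < c e}) x y"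
  have sp: "spanning_tree n ends E T"
    using T by (rule is_MST_spanning_tree)
  have fin: "finite T"
    using sp by (rule spanning_tree_finite)
  \<comment> \<open>Trees are defined by their number of edges, so acyclicity is derived here:
    otherwise \<open>T - {e}\<close> would connect all vertices with fewer than \<open>n - 1\<close>
    edges.\<close>
  have sep: "\<not> conn ends (T - {e}) x y"
  proof
    assume xy: "conn ends (T - {e}) x y"
    have "conn ends (T - {e}) p q" if "conn ends T p q" for p q
      using that
    proof (rule conn_lift)
      fix g p q assume g: "g \<in> T" "joins ends g p q"
      then show "conn ends (T - {e}) p q"
        using xy joins_unique[OF e(2), of p q]
        by (cases "g = e") (auto intro: conn_sym conn_edge)
    qed
    then have "n - 1 \<le> card (T - {e})"
      using fin assms(4) by (intro card_connecting_ge[where ends = ends]) (use spanning_tree_conn[OF sp] in fastforce)+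
    moreover have "card (T - {e}) < card T"
      using fin e(1) by (rule card_Diff1_less)
    ultimately show False
      using sp by (simp add: spanning_tree_def)
  qed
  define X where "X = {z. conn ends (T - {e}) x z}"
  have X: "x \<in> X" "y \<notin> X"
    using sep by (auto simp: X_def)
  obtain f s t where f: "f \<in> T - {e} \<union> {f \<in> E. c f < c e}" "joins ends f s t" "s \<in> X" "t \<notin> X"
    using conn_crossing[OF bypass X] .
  have "f \<notin> T - {e}"
    using f(2-4) conn_trans[of ends "T - {e}" x s t] conn_edge[of f "T - {e}" ends s t] unfolding X_def by auto
  then have f_E: "f \<in> E" "c f < c e" "f \<notin> T"
    using f(1) by auto
  let ?T' = "insert f (T - {e})"
  have sub: "T - {e} \<subseteq> ?T'"
    by auto
  \<comment> \<open>The inserted set is \<open>T\<close> itself. Since \<open>t\<close> is not on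
    the side of \<open>x\<close>, the split along \<open>e\<close> puts it on the side of
    \<open>y\<close>, so \<open>f\<close> reconnects the two sides.\<close>
  have "conn ends (insert e (T - {e})) x t"
    using spanning_tree_conn[OF sp \<open>x < n\<close>] range[OF f_E(1) f(2)] e(1) by (simp add: insert_absorb)
  then obtain s' t' where "joins ends e s' t'" "conn ends (T - {e}) x s'" "conn ends (T - {e}) t' t"
    using conn_insert_split[of ends e "T - {e}" x t] f(4) unfolding X_def by auto
  then have yt: "conn ends (T - {e}) y t"
    using joins_unique[OF e(2), of s' t'] sep by auto
  have "conn ends ?T' x s"
    using f(3) unfolding X_def by (auto intro: conn_mono)
  also have "conn ends ?T' s t"
    using f(2) by (intro conn_edge[of f]) auto
  also have "conn ends ?T' t y"
    using conn_mono[OF yt sub] by (rule conn_sym)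
  finally have xy: "conn ends ?T' x y" .
  have lift: "conn ends ?T' p q" if "conn ends T p q" for p q
    using that
  proof (rule conn_lift)
    fix g p q assume g: "g \<in> T" "joins ends g p q"
    then show "conn ends ?T' p q"
      using xy joins_unique[OF e(2), of p q]
      by (cases "g = e") (auto intro: conn_sym conn_edge)
  qed
  have "weight c T \<le> weight c ?T'"
    using spanning_tree_swap(1)[OF sp e(1) f_E(1,3) lift] by (rule is_MST_le[OF T])
  moreover have "weight c ?T' = weight c T - c e + c f"
    using spanning_tree_swap(2)[OF sp e(1) f_E(1,3) lift] .
  ultimately show False
    using f_E(2) by simp
qed

text \<open>Cut property. If the tree edges of cost at most \<open>c e\<close> did not connect
  \<open>x\<close> to \<open>y\<close>, the tree path would leave the component of \<open>x\<close>
  along a costlier edge, which could be swapped for \<open>e\<close>.\<close>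

lemma MST_minimax:
  assumes T: "is_MST n ends c E T" and e: "e \<in> E" "joins ends e x y" and "x < n" "y < n"
  shows "conn ends {f \<in> T. c f \<le> c e} x y"
proof (rule ccontr)
  assume sep: "\<not> ?thesis"
  have sp: "spanning_tree n ends E T"
    using T by (rule is_MST_spanning_tree)
  have e_T: "e \<notin> T"
    using sep conn_edge[OF _ e(2)] by auto
  define X where "X = {z. conn ends {f \<in> T. c f \<le> c e} x z}"
  have X: "x \<in> X" "y \<notin> X"
    using sep by (auto simp: X_def)
  obtain f s t where f: "f \<in> T" "joins ends f s t" "s \<in> X" "t \<notin> X"
    and lift: "\<And>p q. conn ends T p q \<Longrightarrow> conn ends (insert e (T - {f})) p q"
    using exchange_across_cut[OF spanning_tree_finite[OF sp] spanning_tree_conn[OF sp assms(4,5)] X e(2)] by metis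
  have "\<not> c f \<le> c e"
    using f conn_trans[of ends _ x s t] conn_edge[of f "{f \<in> T. c f \<le> c e}" ends s t] unfolding X_def by auto
  moreover have "weight c T \<le> weight c (insert e (T - {f}))"
    using spanning_tree_swap(1)[OF sp f(1) e(1) e_T lift] by (rule is_MST_le[OF T])
  moreover have "weight c (insert e (T - {f})) = weight c T - c f + c e"
    using spanning_tree_swap(2)[OF sp f(1) e(1) e_T lift] .
  ultimately show False
    by simp
qed

lemma finite_MST_exists:
  assumes "finite E" "spanning_tree n ends E T"
  obtains T' where "is_MST n ends c E T'"
proof -
  have "finite {T. spanning_tree n ends E T}"
    by (rule finite_subset[of _ "Pow E"]) (use assms(1) in \<open>auto simp: spanning_tree_def\<close>)
  then obtain T' where "T' \<in> {T. spanning_tree n ends E T}"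
    "\<And>T. T \<in> {T. spanning_tree n ends E T} \<Longrightarrow> weight c T' \<le> weight c T"
    using assms(2) ex_min_if_finite[of "weight c ` {T. spanning_tree n ends E T}"]
    by (smt (verit, best) arg_min_if_finite(1) arg_min_least empty_iff mem_Collect_eq)
  then show ?thesis
    using that by (auto simp: is_MST_def)
qed

section \<open>Savings from local configurations\<close>

text \<open>The deterministic setting of the saving argument: \<open>J\<close> indexes the
  configurations, and \<open>C\<close> is connected by edges of cost at most \<open>r\<close>. The
  finite set \<open>F\<close> is an explicit witness for connectivity at the middle costs; it is
  later merged with a given second tree, and its edges stay inside \<open>C\<close>.\<close>

locale local_configurations =
  fixes n :: nat and ends :: "'e \<Rightarrow> nat \<times> nat" and c :: "'e \<Rightarrow> real" and E :: "'e set"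
    and r :: real and C :: "nat set" and F :: "'e set" and J :: "'j set"
    and a b u v w :: "'j \<Rightarrow> nat" and eab eau ebv ebw :: "'j \<Rightarrow> 'e"
  assumes range: "\<And>e p q. e \<in> E \<Longrightarrow> joins ends e p q \<Longrightarrow> p < n \<and> q < n"
    and c_nonneg: "\<And>e. e \<in> E \<Longrightarrow> 0 \<le> c e"
    and r_pos: "0 < r"
    and C_less: "\<And>x. x \<in> C \<Longrightarrow> x < n"
    and C_low: "\<And>x y. x \<in> C \<Longrightarrow> y \<in> C \<Longrightarrow> conn ends {e \<in> E. c e \<le> r} x y"
    and F_finite: "finite F"
    and F_E: "F \<subseteq> E"
    and F_mid: "\<And>e. e \<in> F \<Longrightarrow> r < c e \<and> c e \<le> 2 * r"
    and F_C: "\<And>e p q. e \<in> F \<Longrightarrow> joins ends e p q \<Longrightarrow> p \<in> C \<and> q \<in> C"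
    and C_mid: "\<And>x y. x \<in> C \<Longrightarrow> y \<in> C \<Longrightarrow> conn ends F x y"
    and J_finite: "finite J"
    and less: "\<And>j. j \<in> J \<Longrightarrow> a j < n \<and> b j < n"
    and ab_C: "\<And>j. j \<in> J \<Longrightarrow> a j \<notin> C \<and> b j \<notin> C"
    and a_b: "\<And>j. j \<in> J \<Longrightarrow> a j \<noteq> b j"
    and uvw_C: "\<And>j. j \<in> J \<Longrightarrow> u j \<in> C \<and> v j \<in> C \<and> w j \<in> C"
    and v_w: "\<And>j. j \<in> J \<Longrightarrow> v j \<noteq> w j"
    and edges_E: "\<And>j. j \<in> J \<Longrightarrow> eab j \<in> E \<and> eau j \<in> E \<and> ebv j \<in> E \<and> ebw j \<in> E"
    and joins_ab: "\<And>j. j \<in> J \<Longrightarrow> joins ends (eab j) (a j) (b j)"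
    and joins_au: "\<And>j. j \<in> J \<Longrightarrow> joins ends (eau j) (a j) (u j)"
    and joins_bv: "\<And>j. j \<in> J \<Longrightarrow> joins ends (ebv j) (b j) (v j)"
    and joins_bw: "\<And>j. j \<in> J \<Longrightarrow> joins ends (ebw j) (b j) (w j)"
    and cost_ab: "\<And>j. j \<in> J \<Longrightarrow> c (eab j) \<le> r"
    and cost_au: "\<And>j. j \<in> J \<Longrightarrow> c (eau j) \<le> r"
    and cost_bv: "\<And>j. j \<in> J \<Longrightarrow> 2 * r < c (ebv j) \<and> c (ebv j) \<le> 4 * r"
    and cost_bw: "\<And>j. j \<in> J \<Longrightarrow> 2 * r < c (ebw j) \<and> c (ebw j) \<le> 4 * r"
    and at_a: "\<And>j e x. j \<in> J \<Longrightarrow> e \<in> E \<Longrightarrow> joins ends e (a j) x \<Longrightarrow>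
      e = eab j \<or> e = eau j \<or> 5 * r < c e"
    and at_b: "\<And>j e x. j \<in> J \<Longrightarrow> e \<in> E \<Longrightarrow> joins ends e (b j) x \<Longrightarrow>
      e = eab j \<or> e = ebv j \<or> e = ebw j \<or> 5 * r < c e"
    and disjoint: "\<And>i j. i \<in> J \<Longrightarrow> j \<in> J \<Longrightarrow> i \<noteq> j \<Longrightarrow> {a i, b i} \<inter> {a j, b j} = {}"
begin

text \<open>By the minimax property the tree leaves \<open>b j\<close> along an edge of cost at most
  \<open>c (eab j)\<close>, and \<open>eab j\<close> is the only edge at \<open>b j\<close> that
  cheap.\<close>

lemma ab_in_MST:
  assumes T: "is_MST n ends c E T" and j: "j \<in> J"
  shows "eab j \<in> T"
proof -
  have "conn ends {f \<in> T. c f \<le> c (eab j)} (b j) (a j)"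
    by (rule MST_minimax[OF T]) (use edges_E[OF j] joins_ab[OF j] less[OF j] in \<open>auto simp: joins_sym\<close>)
  then obtain f s t where f: "f \<in> T" "c f \<le> c (eab j)" "joins ends f s t" "s \<in> {b j}"
    by (rule conn_crossing[of _ _ _ _ "{b j}"]) (use a_b[OF j] in auto)
  moreover have "f \<in> E"
    using f(1) spanning_tree_subset[OF is_MST_spanning_tree[OF T]] by auto
  ultimately show ?thesis
    using at_b[OF j \<open>f \<in> E\<close>, of t] cost_ab[OF j] cost_bv[OF j] cost_bw[OF j] r_pos by auto
qed

text \<open>The same argument for the cut around \<open>{a j, b j}\<close>: the only edge of cost at
  most \<open>r\<close> that leaves this pair is \<open>eau j\<close>.\<close>

lemma au_in_MST:
  assumes T: "is_MST n ends c E T" and j: "j \<in> J"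
  shows "eau j \<in> T"
proof -
  have u: "u j \<notin> {a j, b j}"
    using uvw_C[OF j] ab_C[OF j] by auto
  have "conn ends {f \<in> T. c f \<le> c (eau j)} (a j) (u j)"
    by (rule MST_minimax[OF T])
      (use edges_E[OF j] joins_au[OF j] less[OF j] uvw_C[OF j] C_less in auto)
  then obtain f s t where f: "f \<in> T" "c f \<le> c (eau j)" "joins ends f s t" "s \<in> {a j, b j}" "t \<notin> {a j, b j}"
    by (rule conn_crossing[of _ _ _ _ "{a j, b j}"]) (use u in auto)
  have "f \<in> E"
    using f(1) spanning_tree_subset[OF is_MST_spanning_tree[OF T]] by auto
  have "f \<noteq> eab j"
    using joins_unique[OF joins_ab[OF j], of s t] f(3-5) by auto
  then have "f = eau j"
    using f at_a[OF j \<open>f \<in> E\<close>, of t] at_b[OF j \<open>f \<in> E\<close>, of t]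
      cost_au[OF j] cost_bv[OF j] cost_bw[OF j] r_pos by auto
  with f(1) show ?thesis
    by simp
qed

lemma conn_low_C:
  assumes T: "is_MST n ends c E T" and "x \<in> C" "y \<in> C"
  shows "conn ends {f \<in> T. c f \<le> r} x y"
  using C_low[OF assms(2,3)]
proof (rule conn_lift)
  fix e p q assume e: "e \<in> {e \<in> E. c e \<le> r}" "joins ends e p q"
  then have "conn ends {f \<in> T. c f \<le> c e} p q"
    using range[of e p q] by (intro MST_minimax[OF T]) auto
  then show "conn ends {f \<in> T. c f \<le> r} p q"
    using e(1) by (auto elim!: conn_mono)
qed

text \<open>The path of edges of cost at most \<open>r\<close> closes a cycle on which
  \<open>e\<close> is strictly the costliest edge.\<close>

lemma mid_notin_MST:
  assumes T: "is_MST n ends c E T" and e: "e \<in> E" "r < c e" "joins ends e x y"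
    and low: "conn ends {f \<in> E. c f \<le> r} x y"
  shows "e \<notin> T"
proof
  assume "e \<in> T"
  then have "\<not> conn ends (T - {e} \<union> {f \<in> E. c f < c e}) x y"
    using range[OF e(1,3)] by (intro MST_edge_not_bypassed[OF T _ e(3)] range) auto
  moreover have "conn ends (T - {e} \<union> {f \<in> E. c f < c e}) x y"
    using low by (rule conn_mono) (use e(2) in auto)
  ultimately show False
    by simp
qed

lemma F_notin_MST: "is_MST n ends c E T \<Longrightarrow> F \<inter> T = {}"
proof -
  assume T: "is_MST n ends c E T"
  have "e \<notin> T" if e: "e \<in> F" for e
  proof -
    obtain p q where pq: "joins ends e p q"
      by (cases "ends e") (auto simp: joins_def)
    show ?thesis
      using F_mid[OF e] F_C[OF e pq] F_E e by (intro mid_notin_MST[OF T _ _ pq] C_low) auto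
  qed
  then show ?thesis
    by auto
qed

text \<open>The cheap route runs from \<open>b j\<close> over \<open>a j\<close> and
  \<open>u j\<close> into \<open>C\<close>. It keeps \<open>ebv j\<close> and \<open>ebw j\<close>
  out of the first tree.\<close>

lemma conn_low_b:
  assumes j: "j \<in> J" and "x \<in> C"
  shows "conn ends {f \<in> E. c f \<le> r} (b j) x"
proof -
  have "conn ends {f \<in> E. c f \<le> r} (b j) (a j)"
    by (rule conn_edge[of "eab j"])
      (use edges_E[OF j] cost_ab[OF j] joins_ab[OF j] in \<open>auto simp: joins_sym\<close>)
  also have "conn ends {f \<in> E. c f \<le> r} (a j) (u j)"
    by (rule conn_edge[of "eau j"]) (use edges_E[OF j] cost_au[OF j] joins_au[OF j] in auto)
  also have "conn ends {f \<in> E. c f \<le> r} (u j) x"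
    using uvw_C[OF j] assms(2) by (intro C_low) auto
  finally show ?thesis .
qed

lemma bv_notin_MST: "is_MST n ends c E T \<Longrightarrow> j \<in> J \<Longrightarrow> ebv j \<notin> T"
  using edges_E[of j] cost_bv[of j] r_pos uvw_C[of j]
  by (intro mid_notin_MST[OF _ _ _ joins_bv] conn_low_b) auto

lemma bw_notin_MST: "is_MST n ends c E T \<Longrightarrow> j \<in> J \<Longrightarrow> ebw j \<notin> T"
  using edges_E[of j] cost_bw[of j] r_pos uvw_C[of j]
  by (intro mid_notin_MST[OF _ _ _ joins_bw] conn_low_b) auto

lemma eau_inj: "inj_on eau J"
proof (rule inj_onI, rule ccontr)
  fix i j assume ij: "i \<in> J" "j \<in> J" "eau i = eau j" "i \<noteq> j"
  then have "a i = a j \<or> a i = u j"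
    using joins_unique[OF joins_au[OF ij(1)], of "a j" "u j"] joins_au[OF ij(2)] by auto
  then show False
    using disjoint[OF ij(1,2,4)] ab_C[OF ij(1)] uvw_C[OF ij(2)] by auto
qed

lemma eab_notin_eau: "j \<in> J \<Longrightarrow> eab j \<notin> eau ` J"
proof
  assume j: "j \<in> J" and "eab j \<in> eau ` J"
  then obtain i where i: "i \<in> J" "eab j = eau i"
    by auto
  then have "u i = a j \<or> u i = b j"
    using joins_unique[OF joins_ab[OF j], of "a i" "u i"] joins_au[OF i(1)] by auto
  then show False
    using uvw_C[OF i(1)] ab_C[OF j] by auto
qed

text \<open>Contracting every \<open>a\<close> and \<open>b\<close> to the attached \<open>u\<close> maps cheap paths of the tree to paths
  avoiding all edges \<open>au\<close>.\<close>
lemma conn_C_avoiding_au: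
  assumes T: "is_MST n ends c E T" and x: "x \<in> C" and y: "y \<in> C"
  shows "conn ends (T - eau ` J) x y"
proof -
  define h where "h z = (if \<exists>j\<in>J. z \<in> {a j, b j} then u (SOME j. j \<in> J \<and> z \<in> {a j, b j}) else z)" for z
  have h_ab: "h z = u j" if "j \<in> J" "z \<in> {a j, b j}" for z j
  proof -
    have "(SOME j. j \<in> J \<and> z \<in> {a j, b j}) = j"
      by (rule some_equality) (use that disjoint in blast)+
    with that show ?thesis
      unfolding h_def by auto
  qed
  have h_id: "h z = z" if "\<And>j. j \<in> J \<Longrightarrow> z \<notin> {a j, b j}" for z
    using that unfolding h_def by auto
  have h_C: "h z = z" if "z \<in> C" for z
    using that ab_C by (intro h_id) auto
  have "conn ends (T - eau ` J) (h x) (h y)"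
    using conn_low_C[OF T x y]
  proof (rule conn_map)
    fix e p q assume e: "e \<in> {f \<in> T. c f \<le> r}" and pq: "joins ends e p q"
    have e_E: "e \<in> E"
      using e spanning_tree_subset[OF is_MST_spanning_tree[OF T]] by auto
    \<comment> \<open>An edge of cost at most \<open>r\<close> at \<open>a j\<close> or
      \<open>b j\<close> is \<open>eab j\<close> or \<open>eau j\<close>, and the contraction sends
      both ends of either one to \<open>u j\<close>.\<close>
    have special: "h p' = h q'" if j: "j \<in> J" and p': "p' \<in> {a j, b j}" "joins ends e p' q'" for p' q' j
    proof -
      have "e = eab j \<or> e = eau j"
        using p' at_a[OF j e_E, of q'] at_b[OF j e_E, of q'] e cost_bv[OF j] cost_bw[OF j] r_pos by auto
      then have "q' \<in> {a j, b j} \<or> q' = u j"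
        using joins_unique[OF joins_ab[OF j], of p' q'] joins_unique[OF joins_au[OF j], of p' q'] p'(2)
          p'(1) by auto
      then show ?thesis
        using h_ab[OF j] p'(1) h_C uvw_C[OF j] by auto
    qed
    show "conn ends (T - eau ` J) (h p) (h q)"
    proof (cases "\<exists>j\<in>J. p \<in> {a j, b j} \<or> q \<in> {a j, b j}")
      case True
      then have "h p = h q"
        using special pq joins_sym by metis
      then show ?thesis
        by simp
    next
      case False
      then have "e \<notin> eau ` J"
        using joins_au joins_unique[OF pq] by blast
      moreover have "h p = p" "h q = q"
        using False by (auto intro!: h_id)
      ultimately show ?thesis
        using e pq by (auto intro: conn_edge)
    qed
  qed
  then show ?thesis
    using h_C x y by simp
qed

text \<open>After the exchange \<open>a j\<close> still hangs on \<open>b j\<close> by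
  \<open>eab j\<close>, \<open>b j\<close> reaches \<open>C\<close> by \<open>e' j\<close>, and
  \<open>C\<close> stays connected without any \<open>eau\<close>. Both families of edges are
  indexed injectively by \<open>J\<close>, so the number of edges is unchanged.\<close>

lemma first_tree_exchange:
  assumes T: "is_MST n ends c E T"
    and e': "\<And>j. j \<in> J \<Longrightarrow> e' j = ebv j \<or> e' j = ebw j"
  shows "spanning_tree n ends E (T - eau ` J \<union> e' ` J)"
    and "weight c (T - eau ` J \<union> e' ` J) = weight c T - (\<Sum>j\<in>J. c (eau j)) + (\<Sum>j\<in>J. c (e' j))"
proof -
  let ?A = "T - eau ` J \<union> e' ` J"
  have sp: "spanning_tree n ends E T"
    using T by (rule is_MST_spanning_tree)
  have fin: "finite T"
    using sp by (rule spanning_tree_finite)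
  have au_T: "eau ` J \<subseteq> T"
    using au_in_MST[OF T] by auto
  have e'_T: "e' ` J \<inter> T = {}"
    using e' bv_notin_MST[OF T] bw_notin_MST[OF T] by fastforce
  have e'_joins: "\<exists>z\<in>C. joins ends (e' j) (b j) z" if "j \<in> J" for j
    using e'[OF that] joins_bv[OF that] joins_bw[OF that] uvw_C[OF that] by auto
  have e'_inj: "inj_on e' J"
  proof (rule inj_onI, rule ccontr)
    fix i j assume ij: "i \<in> J" "j \<in> J" "e' i = e' j" "i \<noteq> j"
    obtain z z' where z: "z \<in> C" "joins ends (e' i) (b i) z" "z' \<in> C" "joins ends (e' j) (b j) z'"
      using e'_joins ij(1,2) by blast
    then have "b i = b j \<or> b i = z'"
      using ij(3) joins_unique[OF z(2), of "b j" z'] by auto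
    then show False
      using disjoint[OF ij(1,2,4)] ab_C[OF ij(1)] z(3) by auto
  qed
  have "card ?A = card (T - eau ` J) + card (e' ` J)"
    using fin J_finite e'_T by (intro card_Un_disjoint) auto
  also have "\<dots> = card T - card J + card J"
    using fin J_finite au_T by (simp add: card_Diff_subset card_image eau_inj e'_inj)
  also have "\<dots> = card T"
    using card_mono[OF fin au_T] by (simp add: card_image eau_inj)
  finally have card: "card ?A = card T" .
  have lift: "conn ends ?A p q" if "conn ends T p q" for p q
    using that
  proof (rule conn_lift)
    fix e p q assume e: "e \<in> T" "joins ends e p q"
    show "conn ends ?A p q"
    proof (cases "e \<in> eau ` J")
      case False
      then show ?thesis
        using e by (auto intro: conn_edge)
    next
      case True
      then obtain j where j: "j \<in> J" "e = eau j"
        by auto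
      obtain z where z: "z \<in> C" "joins ends (e' j) (b j) z"
        using e'_joins j(1) by blast
      have "conn ends ?A (a j) (b j)"
        using ab_in_MST[OF T j(1)] eab_notin_eau[OF j(1)] joins_ab[OF j(1)]
        by (intro conn_edge[of "eab j"]) auto
      also have "conn ends ?A (b j) z"
        using z(2) j(1) by (intro conn_edge[of "e' j"]) auto
      also have "conn ends ?A z (u j)"
        by (rule conn_mono[OF conn_C_avoiding_au[OF T z(1)]]) (use uvw_C[OF j(1)] in auto)
      finally have "conn ends ?A (a j) (u j)" .
      then show ?thesis
        using joins_unique[OF joins_au[OF j(1)], of p q] e(2) j(2) by (auto intro: conn_sym)
    qed
  qed
  have "e' j \<in> E" if "j \<in> J" for j
    using e'[OF that] edges_E[OF that] by auto
  then have "?A \<subseteq> E"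
    using spanning_tree_subset[OF sp] by auto
  then show "spanning_tree n ends E ?A"
    using sp lift card fin J_finite unfolding spanning_tree_iff_conn by simp
  have "weight c ?A = weight c (T - eau ` J) + weight c (e' ` J)"
    unfolding weight_def using fin J_finite e'_T by (intro sum.union_disjoint) auto
  also have "\<dots> = weight c T - (\<Sum>j\<in>J. c (eau j)) + (\<Sum>j\<in>J. c (e' j))"
    unfolding weight_def using fin au_T by (simp add: sum_diff sum.reindex eau_inj e'_inj)
  finally show "weight c ?A = weight c T - (\<Sum>j\<in>J. c (eau j)) + (\<Sum>j\<in>J. c (e' j))" .
qed

text \<open>The edges \<open>eau j\<close> are inserted one at a time, each across the cut around
  \<open>a j\<close>. The edge removed there is not an \<open>eau i\<close> inserted earlier, and it
  is neither \<open>eab j\<close> nor \<open>eau j\<close>, because these lie in \<open>T1\<close>;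
  hence it costs more than \<open>5 * r\<close>. The subset \<open>J'\<close> carries the
  induction.\<close>

lemma second_tree_exchange:
  assumes T1: "is_MST n ends c E T1" and T: "spanning_tree n ends E T" "T \<inter> T1 = {}"
    and "J' \<subseteq> J"
  shows "\<exists>B. spanning_tree n ends E B \<and> B \<subseteq> T \<union> eau ` J' \<and>
    weight c B \<le> weight c T - (\<Sum>j\<in>J'. 5 * r - c (eau j))"
  using finite_subset[OF assms(4) J_finite] assms(4)
proof (induction J' rule: finite_induct)
  case empty
  show ?case
    using T by auto
next
  case (insert j J')
  then obtain B where B: "spanning_tree n ends E B" "B \<subseteq> T \<union> eau ` J'"
    "weight c B \<le> weight c T - (\<Sum>j\<in>J'. 5 * r - c (eau j))"
    by auto
  have j: "j \<in> J" "j \<notin> J'" and J': "J' \<subseteq> J"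
    using insert by auto
  have u: "u j \<notin> {a j}" "u j < n"
    using uvw_C[OF j(1)] ab_C[OF j(1)] C_less by auto
  obtain f s t where f: "f \<in> B" "joins ends f s t" "s \<in> {a j}"
    and lift: "\<And>p q. conn ends B p q \<Longrightarrow> conn ends (insert (eau j) (B - {f})) p q"
    using exchange_across_cut[OF spanning_tree_finite[OF B(1)] _ _ u(1) joins_au[OF j(1)], of thesis]
      spanning_tree_conn[OF B(1), of "a j" "u j"] less[OF j(1)] u(2) by blast
  have f_a: "joins ends f (a j) t"
    using f by auto
  have "f \<notin> eau ` J'"
  proof
    assume "f \<in> eau ` J'"
    then obtain i where i: "i \<in> J'" "f = eau i"
      by auto
    then have "i \<in> J" "i \<noteq> j"
      using J' j by auto
    then have "a j = a i \<or> a j = u i"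
      using joins_unique[OF joins_au, of i "a j" t] f_a i by auto
    then show False
      using disjoint[OF \<open>i \<in> J\<close> j(1) \<open>i \<noteq> j\<close>] ab_C[OF j(1)] uvw_C[OF \<open>i \<in> J\<close>] by auto
  qed
  then have f_T: "f \<in> T"
    using f(1) B(2) by auto
  then have "f \<in> E" "f \<noteq> eab j" "f \<noteq> eau j"
    using T ab_in_MST[OF T1 j(1)] au_in_MST[OF T1 j(1)] spanning_tree_subset[OF T(1)] by auto
  then have c_f: "5 * r < c f"
    using at_a[OF j(1) _ f_a] by auto
  have "eau j \<notin> B"
    using B(2) T(2) au_in_MST[OF T1 j(1)] inj_onD[OF eau_inj] j J' by blast
  then have "spanning_tree n ends E (insert (eau j) (B - {f}))"
    and "weight c (insert (eau j) (B - {f})) = weight c B - c f + c (eau j)"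
    using spanning_tree_swap[OF B(1) f(1) _ _ lift] edges_E[OF j(1)] by auto
  moreover have "insert (eau j) (B - {f}) \<subseteq> T \<union> eau ` insert j J'"
    using B(2) by auto
  ultimately show ?case
    using B(3) c_f insert.hyps by (intro exI[of _ "insert (eau j) (B - {f})"]) auto
qed

lemma m2_le:
  assumes "spanning_tree n ends E A" "spanning_tree n ends E B" "A \<inter> B = {}"
  shows "m2 n ends c E \<le> weight c A + weight c B"
proof -
  have nonneg: "0 \<le> weight c X" if "spanning_tree n ends E X" for X
    unfolding weight_def using spanning_tree_subset[OF that] c_nonneg by (intro sum_nonneg) auto
  show ?thesis
    unfolding m2_def
  proof (rule cInf_lower)
    show "bdd_below {weight c A + weight c B |A B.
        spanning_tree n ends E A \<and> spanning_tree n ends E B \<and> A \<inter> B = {}}"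
      by (rule bdd_belowI[of _ 0]) (auto intro!: add_nonneg_nonneg nonneg)
  qed (use assms in auto)
qed

text \<open>Per configuration the first tree changes by at most \<open>4 * r - c (eau j)\<close> and
  the second by at most \<open>c (eau j) - 5 * r\<close>. The costs of \<open>eau j\<close> cancel
  and \<open>r\<close> is saved.\<close>

lemma good_event_configurations: "good_event n ends c E (real (card J) * r)"
  unfolding good_event_def
proof (intro allI impI)
  fix T1 T2 assume T1: "is_MST n ends c E T1" and T2: "spanning_tree n ends (E - T1) T2"
  \<comment> \<open>\<open>T2\<close> is arbitrary and \<open>E - T1\<close> may be infinite.
    Passing to a minimum spanning tree of the finite set \<open>T2 \<union> F\<close> does not
    increase the weight and makes the cycle property available.\<close>
  have "spanning_tree n ends (T2 \<union> F) T2"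
    using T2 by (auto simp: spanning_tree_def)
  moreover have "finite (T2 \<union> F)"
    using F_finite spanning_tree_finite[OF T2] by simp
  ultimately obtain T where T: "is_MST n ends c (T2 \<union> F) T"
    using finite_MST_exists by blast
  have T_T2: "weight c T \<le> weight c T2"
    using T \<open>spanning_tree n ends (T2 \<union> F) T2\<close> by (rule is_MST_le)
  have T2_F: "T2 \<union> F \<subseteq> E" "(T2 \<union> F) \<inter> T1 = {}"
    using spanning_tree_subset[OF T2] F_E F_notin_MST[OF T1] by auto
  have T_sub: "T \<subseteq> T2 \<union> F"
    using spanning_tree_subset[OF is_MST_spanning_tree[OF T]] .
  have T_sp: "spanning_tree n ends E T" and T_T1: "T \<inter> T1 = {}"
    using is_MST_spanning_tree[OF T] T2_F T_sub by (auto simp: spanning_tree_def)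
  have not_both: "ebv j \<notin> T \<or> ebw j \<notin> T" if j: "j \<in> J" for j
  proof (rule ccontr)
    assume "\<not> ?thesis"
    then have both: "ebv j \<in> T" "ebw j \<in> T"
      by auto
    \<comment> \<open>If both edges were in \<open>T\<close>, the edge \<open>ebv j\<close> followed
      by a path in \<open>F\<close> from \<open>v j\<close> to \<open>w j\<close> would bypass
      \<open>ebw j\<close>: the edges of \<open>F\<close> cost at most \<open>2 * r\<close>, which
      is less than \<open>c (ebw j)\<close>.\<close>
    let ?G = "T - {ebw j} \<union> {f \<in> T2 \<union> F. c f < c (ebw j)}"
    have "ebv j \<noteq> ebw j"
      using joins_unique[OF joins_bv[OF j], of "b j" "w j"] joins_bw[OF j] v_w[OF j] by auto
    then have "conn ends ?G (b j) (v j)"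
      using both joins_bv[OF j] by (intro conn_edge[of "ebv j"]) auto
    also have "conn ends ?G (v j) (w j)"
      using C_mid[of "v j" "w j"] uvw_C[OF j] F_mid cost_bw[OF j] by (fastforce elim!: conn_mono)
    finally have "conn ends ?G (b j) (w j)" .
    moreover have "\<not> conn ends ?G (b j) (w j)"
      using both(2) less[OF j] uvw_C[OF j] C_less T2_F(1) range
      by (intro MST_edge_not_bypassed[OF T _ joins_bw[OF j]]) blast+
    ultimately show False
      by simp
  qed
  define e' where "e' j = (if ebw j \<in> T then ebv j else ebw j)" for j
  have e': "e' j = ebv j \<or> e' j = ebw j" "e' j \<notin> T" if "j \<in> J" for j
    using not_both[OF that] by (auto simp: e'_def)
  let ?A = "T1 - eau ` J \<union> e' ` J"
  obtain B where B: "spanning_tree n ends E B" "B \<subseteq> T \<union> eau ` J"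
    "weight c B \<le> weight c T - (\<Sum>j\<in>J. 5 * r - c (eau j))"
    using second_tree_exchange[OF T1 T_sp T_T1 order.refl] by auto
  have "e' j \<notin> T1" if "j \<in> J" for j
    using e'(1)[OF that] bv_notin_MST[OF T1 that] bw_notin_MST[OF T1 that] by auto
  then have "e' ` J \<inter> eau ` J = {}"
    using au_in_MST[OF T1] by auto metis
  moreover have "e' ` J \<inter> T = {}"
    using e'(2) by auto
  moreover have "(P - Q \<union> K) \<inter> B = {}"
    if "K \<inter> Q = {}" "K \<inter> T = {}" "B \<subseteq> T \<union> Q" "T \<inter> P = {}" for P Q K :: "'e set"
    using that by blast
  ultimately have "?A \<inter> B = {}"
    using B(2) T_T1 by blast
  then have "m2 n ends c E \<le> weight c ?A + weight c B"
    using first_tree_exchange(1)[OF T1 e'(1)] B(1) by (intro m2_le)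
  also have "weight c ?A = weight c T1 - (\<Sum>j\<in>J. c (eau j)) + (\<Sum>j\<in>J. c (e' j))"
    by (rule first_tree_exchange(2)[OF T1 e'(1)])
  also have "(\<Sum>j\<in>J. c (e' j)) \<le> (\<Sum>j\<in>J. 4 * r)"
  proof (rule sum_mono)
    fix j assume "j \<in> J"
    then show "c (e' j) \<le> 4 * r"
      using e'(1) cost_bv cost_bw by metis
  qed
  finally show "weight c T1 + weight c T2 \<ge> m2 n ends c E + real (card J) * r"
    using B(3) T_T2 by (simp add: sum_subtractf algebra_simps)
qed

end

section \<open>Measurability of the event\<close>

lemma countable_spanning_trees: "countable E \<Longrightarrow> countable {T. spanning_tree n ends E T}"
  by (rule countable_subset[OF _ countable_Collect_finite_subset[of E]]) (auto simp: spanning_tree_def)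

lemma measurable_weight:
  assumes "\<And>e. e \<in> E \<Longrightarrow> (\<lambda>x. c x e) \<in> borel_measurable M" "spanning_tree n ends E T"
  shows "(\<lambda>x. weight (c x) T) \<in> borel_measurable M"
  unfolding weight_def using assms spanning_tree_subset by (intro borel_measurable_sum) blast

lemma measurable_m2:
  assumes E: "countable E" and c: "\<And>e. e \<in> E \<Longrightarrow> (\<lambda>x. c x e) \<in> borel_measurable M"
  shows "(\<lambda>x. m2 n ends (c x) E) \<in> borel_measurable M"
proof -
  let ?S = "{T. spanning_tree n ends E T}"
  let ?P = "{(A, B). A \<in> ?S \<and> B \<in> ?S \<and> A \<inter> B = {}}"
  have "countable ?P"
    by (rule countable_subset[of _ "?S \<times> ?S"]) (auto intro: countable_spanning_trees[OF E])
  then have "(\<lambda>x. INF (A, B)\<in>?P. weight (c x) A + weight (c x) B) \<in> borel_measurable M"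
    by (intro borel_measurable_cINF_real)
      (auto intro!: borel_measurable_add measurable_weight[where E = E and ends = ends] c simp: split_beta)
  moreover have "m2 n ends (c x) E = (INF (A, B)\<in>?P. weight (c x) A + weight (c x) B)" for x
    unfolding m2_def by (rule arg_cong[of _ _ Inf]) auto
  ultimately show ?thesis
    by simp
qed

text \<open>Every quantifier ranges over spanning trees, which are finite subsets of a countable
  edge set; so only countably many conditions are involved.\<close>

lemma sets_good_event:
  assumes E: "countable E" and c: "\<And>e. e \<in> E \<Longrightarrow> (\<lambda>x. c x e) \<in> borel_measurable M"
  shows "{x \<in> space M. good_event n ends (c x) E \<delta>} \<in> sets M"
proof -
  let ?S = "\<lambda>E. {T. spanning_tree n ends E T}"
  have [measurable]: "(\<lambda>x. weight (c x) T) \<in> borel_measurable M" if "T \<in> ?S E" for T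
    using that by (auto intro: measurable_weight[OF c])
  have [measurable]: "(\<lambda>x. weight (c x) T) \<in> borel_measurable M" if "T \<in> ?S (E - T')" for T T'
    using that by (intro measurable_weight[OF c]) (auto simp: spanning_tree_def)
  have [measurable]: "(\<lambda>x. m2 n ends (c x) E) \<in> borel_measurable M"
    by (rule measurable_m2[OF E c])
  have cS: "countable (?S E)" "countable (?S (E - T))" for T
    by (auto intro!: countable_spanning_trees E)
  have "{x \<in> space M. good_event n ends (c x) E \<delta>} =
    {x \<in> space M. \<forall>T1\<in>?S E. (\<forall>T\<in>?S E. weight (c x) T1 \<le> weight (c x) T) \<longrightarrow>
      (\<forall>T2\<in>?S (E - T1). weight (c x) T1 + weight (c x) T2 \<ge> m2 n ends (c x) E + \<delta>)}"
    unfolding good_event_def is_MST_def by blast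
  also have "\<dots> \<in> sets M"
    by (intro sets.sets_Collect_countable_All' sets.sets_Collect_imp cS) measurable
  finally show ?thesis .
qed

section \<open>A large component\<close>

text \<open>A union of components cannot have size at least \<open>k\<close> while its complement
  does too. If all components were smaller than \<open>k\<close>, adding one more component to a
  largest closed set of size below \<open>k\<close> would give a size in \<open>[k, 2 * k)\<close>,
  leaving more than \<open>k\<close> vertices outside. So some component has at least
  \<open>k\<close> vertices, and then fewer than \<open>k\<close> lie outside it.\<close>

lemma giant_component:
  assumes U: "finite U" "3 * k \<le> card U" and "0 < k"
    and expand: "\<And>X Y. X \<subseteq> U \<Longrightarrow> Y \<subseteq> U \<Longrightarrow> X \<inter> Y = {} \<Longrightarrow> k \<le> card X \<Longrightarrow> k \<le> card Y \<Longrightarrow>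
      \<exists>e\<in>F. \<exists>x\<in>X. \<exists>y\<in>Y. joins ends e x y"
  obtains C where "C \<subseteq> U" "card U < card C + k"
    "\<And>x y. x \<in> C \<Longrightarrow> y \<in> C \<Longrightarrow> conn ends {e \<in> F. fst (ends e) \<in> C \<and> snd (ends e) \<in> C} x y"
proof -
  define G where "G = {e \<in> F. fst (ends e) \<in> U \<and> snd (ends e) \<in> U}"
  define closed where "closed X \<longleftrightarrow> X \<subseteq> U \<and> (\<forall>e\<in>G. \<forall>p q. joins ends e p q \<longrightarrow> p \<in> X \<longrightarrow> q \<in> X)" for X
  define comp where "comp x = {y \<in> U. conn ends G x y}" for x
  have small: "card X < k \<or> card (U - X) < k" if "closed X" for X
  proof (rule ccontr)
    assume "\<not> ?thesis"
    moreover have "X \<subseteq> U"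
      using that by (simp add: closed_def)
    ultimately obtain e x y where e: "e \<in> F" "x \<in> X" "y \<in> U - X" "joins ends e x y"
      using expand[of X "U - X"] by (auto simp: not_less)
    then have "e \<in> G"
      using that unfolding G_def closed_def joins_def by auto
    then show False
      using e that unfolding closed_def by blast
  qed
  have closed_comp: "closed (comp x)" for x
    unfolding closed_def
  proof (intro conjI ballI allI impI)
    fix e p q assume e: "e \<in> G" "joins ends e p q" "p \<in> comp x"
    then have "q \<in> U" "conn ends G x p"
      by (auto simp: G_def joins_def comp_def)
    then show "q \<in> comp x"
      using conn_trans[of ends G x p q] conn_edge[OF e(1,2)] by (simp add: comp_def)
  qed (auto simp: comp_def)
  have "\<exists>x\<in>U. k \<le> card (comp x)"
  proof (rule ccontr)
    assume "\<not> ?thesis"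
    then have comp_small: "card (comp x) < k" if "x \<in> U" for x
      using that by auto
    have "finite {X. closed X \<and> card X < k}"
      by (rule finite_subset[of _ "Pow U"]) (use U(1) in \<open>auto simp: closed_def\<close>)
    moreover have "{} \<in> {X. closed X \<and> card X < k}"
      using \<open>0 < k\<close> by (auto simp: closed_def)
    ultimately obtain X where X: "closed X" "card X < k"
      and X_max: "\<And>X'. closed X' \<Longrightarrow> card X' < k \<Longrightarrow> card X' \<le> card X"
      using finite_has_maximal[of "card ` {X. closed X \<and> card X < k}"]
      by (smt (verit) ex_in_conv finite_imageI image_iff mem_Collect_eq nle_le image_is_empty)
    have X_U: "X \<subseteq> U"
      using X(1) by (simp add: closed_def)
    have "X \<noteq> U"
      using X(2) U(2) by auto
    then obtain x where x: "x \<in> U" "x \<notin> X"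
      using X_U by auto
    let ?Y = "X \<union> comp x"
    have closed_Y: "closed ?Y"
      using X(1) closed_comp[of x] unfolding closed_def by blast
    have fin_Y: "finite ?Y"
      using closed_Y U(1) finite_subset unfolding closed_def by blast
    have "x \<in> comp x"
      using x by (simp add: comp_def)
    then have "card X < card ?Y"
      using x fin_Y by (intro psubset_card_mono) auto
    then have "k \<le> card ?Y"
      using X_max[OF closed_Y] by (meson linorder_not_less)
    moreover have "card ?Y < 2 * k"
      using card_Un_le[of X "comp x"] X(2) comp_small[OF x(1)] by simp
    moreover have "card (U - ?Y) = card U - card ?Y"
      using closed_Y fin_Y unfolding closed_def by (intro card_Diff_subset) auto
    ultimately show False
      using small[OF closed_Y] U(2) by simp
  qed
  then obtain x where x: "x \<in> U" "k \<le> card (comp x)"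
    by auto
  let ?H = "{e \<in> F. fst (ends e) \<in> comp x \<and> snd (ends e) \<in> comp x}"
  \<comment> \<open>A walk from \<open>x\<close> never leaves the component of \<open>x\<close>, so
    the edges inside the component already connect it.\<close>
  have from_x: "conn ends ?H x y" if "conn ends G x y" for y
    using that unfolding conn_def[of ends G]
  proof (induction rule: rtrancl_induct)
    case base
    show ?case by simp
  next
    case (step y z)
    from step.hyps(2) obtain e where e: "e \<in> G" "joins ends e y z"
      unfolding adj_rel_iff by blast
    have "conn ends G x y"
      using step.hyps(1) by (simp add: conn_def)
    then have "y \<in> comp x" "z \<in> comp x"
      using e conn_edge[OF e] conn_trans[of ends G x y z] by (auto simp: comp_def G_def joins_def)
    then have "e \<in> ?H"
      using e by (auto simp: G_def joins_def)
    then show ?case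
      using step.IH conn_edge[of e ?H] e(2) conn_trans by blast
  qed
  show ?thesis
  proof (rule that[of "comp x"])
    show "comp x \<subseteq> U"
      by (auto simp: comp_def)
    have "card (U - comp x) < k"
      using small[OF closed_comp[of x]] x(2) by simp
    moreover have "card (U - comp x) = card U - card (comp x)"
      using U(1) by (intro card_Diff_subset) (auto simp: comp_def)
    ultimately show "card U < card (comp x) + k"
      by simp
    show "conn ends ?H y z" if "y \<in> comp x" "z \<in> comp x" for y z
    proof -
      have "conn ends G x y" "conn ends G x z"
        using that by (simp_all add: comp_def)
      then have "conn ends ?H x y" "conn ends ?H x z"
        by (simp_all only: from_x)
      then show ?thesis
        using conn_sym conn_trans by blast
    qed
  qed
qed

section \<open>Second moment bound\<close>

text \<open>Chebyshev's inequality for the number of events \<open>A i\<close> that occur, localised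
  to \<open>D\<close>. Everything is multiplied by \<open>prob D\<close> instead of conditioning on
  \<open>D\<close>, so \<open>D\<close> may be a null set. The factor \<open>\<rho>\<close> measures
  the failure of pairwise independence.\<close>

lemma (in prob_space) few_events_prob_le:
  assumes "finite I" and D: "D \<in> events" and A: "\<And>i. i \<in> I \<Longrightarrow> A i \<in> events"
    and p_nonneg: "\<And>i. i \<in> I \<Longrightarrow> 0 \<le> p i" and "0 \<le> \<rho>"
    and p: "\<And>i. i \<in> I \<Longrightarrow> prob (D \<inter> A i) = prob D * p i"
    and pp: "\<And>i j. i \<in> I \<Longrightarrow> j \<in> I \<Longrightarrow> i \<noteq> j \<Longrightarrow> prob (D \<inter> (A i \<inter> A j)) \<le> prob D * (\<rho> * p i * p j)"
    and \<mu>: "\<mu> = (\<Sum>i\<in>I. p i)" "0 < \<mu>"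
  shows "{x \<in> D. real (card {i \<in> I. x \<in> A i}) < \<mu> / 2} \<in> events"
    and "prob {x \<in> D. real (card {i \<in> I. x \<in> A i}) < \<mu> / 2} \<le> prob D * (4 * (1 / \<mu> + \<rho> - 1))"
proof -
  define N where "N x = real (card {i \<in> I. x \<in> A i})" for x
  \<comment> \<open>This is \<open>(N x - \<mu>)\<^sup>2\<close> on \<open>D\<close> and 0
    elsewhere, expanded into indicators so that its expectation involves only the probabilities in
    the hypotheses.\<close>
  define Z where "Z x = (\<Sum>i\<in>I. \<Sum>j\<in>I. indicator (D \<inter> (A i \<inter> A j)) x)
    - 2 * \<mu> * (\<Sum>i\<in>I. indicator (D \<inter> A i) x) + \<mu>\<^sup>2 * (indicator D x :: real)" for x
  let ?B = "{x \<in> D. N x < \<mu> / 2}"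
  have N_sum: "N x = (\<Sum>i\<in>I. indicator (A i) x)" for x
    using \<open>finite I\<close> by (simp add: N_def indicator_def sum.If_cases Int_def)
  have Z_eq: "Z x = indicator D x * (N x - \<mu>)\<^sup>2" for x
    unfolding Z_def N_sum indicator_inter_arith power2_diff
    by (simp add: power2_eq_square sum_distrib_left sum_distrib_right algebra_simps sum_product)
  have N_meas: "N \<in> borel_measurable M"
    unfolding N_sum[abs_def] using A by (intro borel_measurable_sum borel_measurable_indicator) auto
  have B: "?B \<in> events"
  proof -
    have "?B = D \<inter> {x \<in> space M. N x < \<mu> / 2}"
      using sets.sets_into_space[OF D] by auto
    also have "\<dots> \<in> events"
      using N_meas D by (intro sets.Int borel_measurable_less) auto
    finally show ?thesis .
  qed
  have int: "integrable M (indicator S :: _ \<Rightarrow> real)" if "S \<in> events" for S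
    using that by (intro integrable_real_indicator) (auto simp: emeasure_eq_measure)
  have Z_has: "has_bochner_integral M Z ((\<Sum>i\<in>I. \<Sum>j\<in>I. prob (D \<inter> (A i \<inter> A j)))
      - 2 * \<mu> * (\<Sum>i\<in>I. prob (D \<inter> A i)) + \<mu>\<^sup>2 * prob D)"
    unfolding Z_def using D A
    by (intro has_bochner_integral_add has_bochner_integral_diff has_bochner_integral_mult_right
        has_bochner_integral_sum has_bochner_integral_real_indicator)
      (auto simp: emeasure_eq_measure)
  then have Z_int: "integrable M Z"
    by (rule has_bochner_integral_iff[THEN iffD1, THEN conjunct1])
  have "expectation Z = (\<Sum>i\<in>I. \<Sum>j\<in>I. prob (D \<inter> (A i \<inter> A j)))
      - 2 * \<mu> * (\<Sum>i\<in>I. prob (D \<inter> A i)) + \<mu>\<^sup>2 * prob D"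
    using Z_has by (rule has_bochner_integral_integral_eq)
  also have "(\<Sum>i\<in>I. prob (D \<inter> A i)) = prob D * \<mu>"
    using p by (simp add: \<mu>(1) sum_distrib_left)
  \<comment> \<open>The diagonal contributes \<open>p i\<close>; granting the nonnegative
    off-diagonal bound there as well lets the double sum factor into
    \<open>\<mu>\<^sup>2\<close>.\<close>
  also have "(\<Sum>i\<in>I. \<Sum>j\<in>I. prob (D \<inter> (A i \<inter> A j))) \<le>
      (\<Sum>i\<in>I. \<Sum>j\<in>I. prob D * (if i = j then p i else 0) + prob D * (\<rho> * p i * p j))"
  proof (intro sum_mono)
    fix i j assume ij: "i \<in> I" "j \<in> I"
    have "0 \<le> prob D * (\<rho> * p i * p j)"
      using p_nonneg ij \<open>0 \<le> \<rho>\<close> by simp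
    then show "prob (D \<inter> (A i \<inter> A j)) \<le>
      prob D * (if i = j then p i else 0) + prob D * (\<rho> * p i * p j)"
      using p[OF ij(1)] pp[OF ij] by (cases "i = j") auto
  qed
  also have "\<dots> = prob D * (\<mu> + \<rho> * \<mu>\<^sup>2)"
    using \<open>finite I\<close> by (simp add: sum.distrib sum_distrib_left[symmetric] sum_distrib_right[symmetric]
        \<mu>(1) power2_eq_square algebra_simps mult.assoc)
  finally have E_Z: "expectation Z \<le> prob D * (\<mu> + (\<rho> - 1) * \<mu>\<^sup>2)"
    by (simp add: algebra_simps power2_eq_square)
  have "(\<mu> / 2)\<^sup>2 * prob ?B = expectation (\<lambda>x. (\<mu> / 2)\<^sup>2 * indicator ?B x)"
    using B sets.sets_into_space[OF B] by (simp add: Int_absorb2)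
  also have "\<dots> \<le> expectation Z"
  proof (rule integral_mono[OF _ Z_int])
    show "integrable M (\<lambda>x. (\<mu> / 2)\<^sup>2 * indicator ?B x)"
      using int[OF B] by simp
    fix x
    show "(\<mu> / 2)\<^sup>2 * indicator ?B x \<le> Z x"
    proof (cases "x \<in> ?B")
      case True
      then have "(\<mu> / 2)\<^sup>2 \<le> (\<mu> - N x)\<^sup>2"
        using \<mu>(2) by (intro power_mono) auto
      with True show ?thesis
        by (simp add: Z_eq power2_commute)
    qed (simp add: Z_eq)
  qed
  also note E_Z
  finally have "prob ?B * (\<mu>\<^sup>2 / 4) \<le> prob D * (\<mu> + (\<rho> - 1) * \<mu>\<^sup>2)"
    by (simp add: power_divide mult.commute)
  then have "prob ?B \<le> prob D * (\<mu> + (\<rho> - 1) * \<mu>\<^sup>2) / (\<mu>\<^sup>2 / 4)"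
    using \<mu>(2) by (simp add: pos_le_divide_eq)
  also have "\<dots> = prob D * (4 * (1 / \<mu> + \<rho> - 1))"
    using \<mu>(2) by (simp add: field_simps power2_eq_square)
  finally show "prob {x \<in> D. real (card {i \<in> I. x \<in> A i}) < \<mu> / 2} \<le> prob D * (4 * (1 / \<mu> + \<rho> - 1))"
    by (simp add: N_def)
  show "{x \<in> D. real (card {i \<in> I. x \<in> A i}) < \<mu> / 2} \<in> events"
    using B by (simp add: N_def)
qed

section \<open>Cylinder events\<close>

lemma
  assumes Q: "prob_space Q" and J: "J \<subseteq> K" "finite J" and X: "\<And>t. t \<in> J \<Longrightarrow> X t \<in> sets Q"
  shows sets_cylinder: "{x \<in> space (PiM K (\<lambda>_. Q)). \<forall>t\<in>J. x t \<in> X t} \<in> sets (PiM K (\<lambda>_. Q))"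
    and measure_cylinder: "measure (PiM K (\<lambda>_. Q)) {x \<in> space (PiM K (\<lambda>_. Q)). \<forall>t\<in>J. x t \<in> X t}
      = (\<Prod>t\<in>J. measure Q (X t))"
proof -
  interpret prob_space Q by fact
  interpret PQ: product_prob_space "\<lambda>_. Q" K ..
  have "{x \<in> space (PiM K (\<lambda>_. Q)). \<forall>t\<in>J. x t \<in> X t} = prod_emb K (\<lambda>_. Q) J (Pi\<^sub>E J X)"
    unfolding prod_emb_def using J by (auto simp: space_PiM Pi_iff)
  then show "{x \<in> space (PiM K (\<lambda>_. Q)). \<forall>t\<in>J. x t \<in> X t} \<in> sets (PiM K (\<lambda>_. Q))"
    and "measure (PiM K (\<lambda>_. Q)) {x \<in> space (PiM K (\<lambda>_. Q)). \<forall>t\<in>J. x t \<in> X t}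
      = (\<Prod>t\<in>J. measure Q (X t))"
    using PQ.measure_PiM_emb[OF J X] sets_PiM_I[OF J(2,1), of X "\<lambda>_. Q"] X by simp_all
qed

text \<open>Cylinders over disjoint coordinate sets merge into one cylinder, whose product formula
  splits again.\<close>

lemma measure_cylinder_Int:
  assumes Q: "prob_space Q" and J: "J \<subseteq> K" "finite J" and X: "\<And>t. t \<in> J \<Longrightarrow> X t \<in> sets Q"
    and J': "J' \<subseteq> K" "finite J'" and X': "\<And>t. t \<in> J' \<Longrightarrow> X' t \<in> sets Q" and "J \<inter> J' = {}"
  defines "M \<equiv> PiM K (\<lambda>_. Q)"
  shows "measure M ({x \<in> space M. \<forall>t\<in>J. x t \<in> X t} \<inter> {x \<in> space M. \<forall>t\<in>J'. x t \<in> X' t}) =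
    measure M {x \<in> space M. \<forall>t\<in>J. x t \<in> X t} * measure M {x \<in> space M. \<forall>t\<in>J'. x t \<in> X' t}"
proof -
  define Y where "Y t = (if t \<in> J then X t else X' t)" for t
  have "{x \<in> space M. \<forall>t\<in>J. x t \<in> X t} \<inter> {x \<in> space M. \<forall>t\<in>J'. x t \<in> X' t} =
    {x \<in> space M. \<forall>t\<in>J \<union> J'. x t \<in> Y t}"
    using \<open>J \<inter> J' = {}\<close> by (auto simp: Y_def)
  also have "measure M \<dots> = (\<Prod>t\<in>J \<union> J'. measure Q (Y t))"
    unfolding M_def using J J' X X' by (intro measure_cylinder[OF Q]) (auto simp: Y_def)
  also have "\<dots> = (\<Prod>t\<in>J. measure Q (Y t)) * (\<Prod>t\<in>J'. measure Q (Y t))"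
    using J J' \<open>J \<inter> J' = {}\<close> by (intro prod.union_disjoint)
  also have "(\<Prod>t\<in>J. measure Q (Y t)) = measure M {x \<in> space M. \<forall>t\<in>J. x t \<in> X t}"
    unfolding M_def using J X by (subst measure_cylinder[OF Q]) (auto simp: Y_def)
  also have "(\<Prod>t\<in>J'. measure Q (Y t)) = measure M {x \<in> space M. \<forall>t\<in>J'. x t \<in> X' t}"
    unfolding M_def using J' X' \<open>J \<inter> J' = {}\<close>
    by (subst measure_cylinder[OF Q]) (auto simp: Y_def intro!: prod.cong)
  finally show ?thesis .
qed

section \<open>Configurations in the random models\<close>

definition upair :: "nat \<Rightarrow> nat \<Rightarrow> nat \<times> nat" where
  "upair a b = (min a b, max a b)"

lemma upair_eq_iff: "upair a b = upair c d \<longleftrightarrow> (a = c \<and> b = d) \<or> (a = d \<and> b = c)"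
  by (auto simp: upair_def min_def max_def)

lemma upair_in_vpairs: "upair a b \<in> vpairs n \<longleftrightarrow> a \<noteq> b \<and> a < n \<and> b < n"
  by (auto simp: upair_def vpairs_def)

lemma joins_upair: "ends e = upair a b \<Longrightarrow> joins ends e a b"
  by (auto simp: upair_def joins_def min_def max_def)

lemma joins_vpairs:
  assumes "joins ends e a b" "ends e \<in> vpairs n"
  shows "ends e = upair a b" "a < n" "b < n" "a \<noteq> b"
  using assms by (auto simp: joins_def upair_def vpairs_def)

lemma finite_vpairs: "finite (vpairs n)"
  by (rule finite_subset[of _ "{..<n} \<times> {..<n}"]) (auto simp: vpairs_def)

lemma vpairs_mono: "m \<le> n \<Longrightarrow> vpairs m \<subseteq> vpairs n"
  by (auto simp: vpairs_def)

section \<open>Candidate tuples and the coordinate conditions that make them configurations\<close>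

type_synonym config = "nat \<times> nat \<times> nat \<times> nat \<times> nat"

definition configs :: "nat \<Rightarrow> nat \<Rightarrow> nat set \<Rightarrow> config set" where
  "configs m n C = {(a, b, u, v, w). a \<in> {m..<n} \<and> b \<in> {m..<n} \<and> a \<noteq> b \<and>
     u \<in> C \<and> v \<in> C \<and> w \<in> C \<and> v \<noteq> w}"

definition star :: "nat \<Rightarrow> nat \<Rightarrow> nat \<Rightarrow> (nat \<times> nat) set" where
  "star n a b = {p \<in> vpairs n. fst p \<in> {a, b} \<or> snd p \<in> {a, b}}"

text \<open>A coordinate \<open>(p, k)\<close> is the \<open>k\<close>-th interarrival time on the pair \<open>p\<close>.  Only the
  Poisson model needs the coordinates with \<open>k = 1\<close>: they make the parallel copies of the four
  cheap edges expensive.\<close>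
fun coords :: "nat \<Rightarrow> config \<Rightarrow> ((nat \<times> nat) \<times> nat) set" where
  "coords n (a, b, u, v, w) =
     star n a b \<times> {0} \<union> {upair a b, upair a u, upair b v, upair b w} \<times> {1}"

text \<open>The vertices \<open>v\<close> and \<open>w\<close> get disjoint windows so that
  exchanging them never gives a second configuration; otherwise the same pair \<open>a\<close>,
  \<open>b\<close> would be counted twice.\<close>

fun window :: "real \<Rightarrow> config \<Rightarrow> (nat \<times> nat) \<times> nat \<Rightarrow> real set" where
  "window r (a, b, u, v, w) t =
     (if t = (upair a b, 0) \<or> t = (upair a u, 0) then {..r}
      else if t = (upair b v, 0) then {2 * r<..3 * r}
      else if t = (upair b w, 0) then {3 * r<..4 * r}
      else {5 * r<..})"

definition is_config :: "nat \<Rightarrow> real \<Rightarrow> config \<Rightarrow> ((nat \<times> nat) \<times> nat \<Rightarrow> real) \<Rightarrow> bool" where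
  "is_config n r i x \<longleftrightarrow> (\<forall>t\<in>coords n i. x t \<in> window r i t)"

lemma upair_in_star:
  "upair c d \<in> star n a b \<longleftrightarrow> c \<noteq> d \<and> c < n \<and> d < n \<and> (c \<in> {a, b} \<or> d \<in> {a, b})"
  by (auto simp: star_def upair_in_vpairs) (auto simp: upair_def min_def max_def split: if_splits)

lemma
  assumes x: "is_config n r (a, b, u, v, w) x" and i: "(a, b, u, v, w) \<in> configs m n C"
    and C: "C \<subseteq> {..<m}" "m \<le> n"
  shows config_ab: "x (upair a b, 0) \<le> r"
    and config_au: "x (upair a u, 0) \<le> r"
    and config_bv: "2 * r < x (upair b v, 0)" "x (upair b v, 0) \<le> 3 * r"
    and config_bw: "3 * r < x (upair b w, 0)" "x (upair b w, 0) \<le> 4 * r"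
    and config_at_a: "\<And>y. y < n \<Longrightarrow> y \<noteq> a \<Longrightarrow> y \<noteq> b \<Longrightarrow> y \<noteq> u \<Longrightarrow> 5 * r < x (upair a y, 0)"
    and config_at_b: "\<And>y. y < n \<Longrightarrow> y \<noteq> b \<Longrightarrow> y \<noteq> a \<Longrightarrow> y \<noteq> v \<Longrightarrow> y \<noteq> w \<Longrightarrow> 5 * r < x (upair b y, 0)"
    and config_copies: "\<And>p. p \<in> {upair a b, upair a u, upair b v, upair b w} \<Longrightarrow> 5 * r < x (p, 1)"
proof -
  have ne: "a \<noteq> b" "v \<noteq> w" "u \<notin> {a, b}" "v \<notin> {a, b}" "w \<notin> {a, b}"
    and less: "a < n" "b < n" "u < n" "v < n" "w < n"
    using i C by (force simp: configs_def)+
  have star: "x (p, 0) \<in> window r (a, b, u, v, w) (p, 0)" if "p \<in> star n a b" for p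
    using x that by (auto simp: is_config_def)
  show "x (upair a b, 0) \<le> r" "x (upair a u, 0) \<le> r" "2 * r < x (upair b v, 0)"
    "x (upair b v, 0) \<le> 3 * r" "3 * r < x (upair b w, 0)" "x (upair b w, 0) \<le> 4 * r"
    using star[of "upair a b"] star[of "upair a u"] star[of "upair b v"] star[of "upair b w"] ne less
    by (auto simp: upair_in_star upair_eq_iff)
  show "5 * r < x (upair a y, 0)" if "y < n" "y \<noteq> a" "y \<noteq> b" "y \<noteq> u" for y
    using star[of "upair a y"] that ne less by (auto simp: upair_in_star upair_eq_iff)
  show "5 * r < x (upair b y, 0)" if "y < n" "y \<noteq> b" "y \<noteq> a" "y \<noteq> v" "y \<noteq> w" for y
    using star[of "upair b y"] that ne less by (auto simp: upair_in_star upair_eq_iff)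
  show "5 * r < x (p, 1)" if "p \<in> {upair a b, upair a u, upair b v, upair b w}" for p
  proof -
    have "x (p, 1) \<in> window r (a, b, u, v, w) (p, 1)"
      using x that unfolding is_config_def by (metis (no_types) coords.simps SigmaI UnI2 insertI1)
    then show ?thesis
      by simp
  qed
qed

text \<open>The two vertices of a configuration determine each other and are told apart by the numbers
  of their cheap edges, hence distinct configurations have disjoint vertex pairs.\<close>
lemma configs_disjoint:
  assumes x: "is_config n r (a, b, u, v, w) x" "is_config n r (a', b', u', v', w') x"
    and i: "(a, b, u, v, w) \<in> configs m n C" "(a', b', u', v', w') \<in> configs m n C"
    and C: "C \<subseteq> {..<m}" "m \<le> n" and r: "0 < r"
    and ne: "(a, b, u, v, w) \<noteq> (a', b', u', v', w')"
  shows "{a, b} \<inter> {a', b'} = {}"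
proof -
  have ab: "a \<noteq> b" "m \<le> a" "m \<le> b" "a < n" "b < n" "a' \<noteq> b'" "m \<le> a'" "m \<le> b'" "a' < n" "b' < n"
    using i by (auto simp: configs_def)
  have uvw: "u < m" "v < m" "w < m" "u' < m" "v' < m" "w' < m"
    using i C by (auto simp: configs_def)
  note c = config_ab[OF x(1) i(1) C] config_au[OF x(1) i(1) C] config_bv[OF x(1) i(1) C]
    config_bw[OF x(1) i(1) C]
  note c' = config_ab[OF x(2) i(2) C] config_au[OF x(2) i(2) C] config_bv[OF x(2) i(2) C]
    config_bw[OF x(2) i(2) C]
  have "a \<noteq> b'"
  proof
    assume "a = b'"
    then show False
      using config_at_a[OF x(1) i(1) C, of v'] c c' r ab uvw by fastforce
  qed
  moreover have "b \<noteq> a'"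
  proof
    assume "b = a'"
    then show False
      using config_at_a[OF x(2) i(2) C, of v] c c' r ab uvw by fastforce
  qed
  moreover have bb': "a = a'" if "b = b'"
    using that config_at_b[OF x(2) i(2) C, of a] c r ab uvw by (fastforce simp: upair_def min.commute max.commute)
  moreover have False if "a = a'"
  proof -
    have "b = b'"
      using that config_at_a[OF x(2) i(2) C, of b] c r ab uvw by fastforce
    moreover have "u = u'"
      using that config_at_a[OF x(2) i(2) C, of u] c r ab uvw by fastforce
    moreover have "v = v'"
      using \<open>b = b'\<close> config_at_b[OF x(2) i(2) C, of v] c c' r ab uvw by fastforce
    moreover have "w = w'"
      using \<open>b = b'\<close> config_at_b[OF x(2) i(2) C, of w] c c' r ab uvw by fastforce
    ultimately show False
      using that ne by simp
  qed
  ultimately show ?thesis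
    by auto
qed

definition low :: "nat \<Rightarrow> real \<Rightarrow> ((nat \<times> nat) \<times> nat \<Rightarrow> real) \<Rightarrow> (nat \<times> nat) set" where
  "low m r x = {p \<in> vpairs m. x (p, 0) \<le> r}"

definition mid :: "nat \<Rightarrow> real \<Rightarrow> ((nat \<times> nat) \<times> nat \<Rightarrow> real) \<Rightarrow> (nat \<times> nat) set" where
  "mid m r x = {p \<in> vpairs m. r < x (p, 0) \<and> x (p, 0) \<le> 2 * r}"

text \<open>The costs enter only through the edge patterns \<open>L\<close> and \<open>D\<close>, so
  a core can be chosen once for each pattern. Paths in \<open>L\<close> may leave \<open>C\<close>;
  paths in \<open>D\<close> may not.\<close>

definition is_core :: "nat \<Rightarrow> (nat \<times> nat) set \<Rightarrow> (nat \<times> nat) set \<Rightarrow> nat set \<Rightarrow> bool" where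
  "is_core m L D C \<longleftrightarrow> C \<subseteq> {..<m} \<and>
     (\<forall>x\<in>C. \<forall>y\<in>C. conn id L x y \<and> conn id {p \<in> D. fst p \<in> C \<and> snd p \<in> C} x y)"

lemma conn_id_image:
  assumes "conn id L x y" "\<And>p. p \<in> L \<Longrightarrow> g p \<in> F \<and> ends (g p) = p"
  shows "conn ends F x y"
  using assms(1)
proof (rule conn_lift)
  fix p q z assume "p \<in> L" "joins id p q z"
  then show "conn ends F q z"
    using assms(2)[of p] by (intro conn_edge[of "g p"]) (auto simp: joins_def)
qed

text \<open>The bridge from coordinates to an arbitrary multigraph: \<open>g p\<close> is the edge
  on \<open>p\<close> whose cost is coordinate 0. By \<open>copies\<close> any other edge on
  \<open>p\<close> costs at least coordinates 0 and 1, hence more than \<open>5 * r\<close> at the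
  vertices \<open>a\<close> and \<open>b\<close> of a configuration. For \<open>g = id\<close> and
  \<open>ends = id\<close> there are no such edges.\<close>

lemma good_event_of_core:
  fixes g :: "nat \<times> nat \<Rightarrow> 'e"
  assumes m: "m \<le> n" and r: "0 < r" and core: "is_core m (low m r x) (mid m r x) C"
    and E: "\<And>e. e \<in> E \<Longrightarrow> ends e \<in> vpairs n" and c: "\<And>e. e \<in> E \<Longrightarrow> 0 \<le> c e"
    and g: "\<And>p. p \<in> vpairs n \<Longrightarrow> g p \<in> E \<and> ends (g p) = p \<and> c (g p) = x (p, 0)"
    and copies: "\<And>e. e \<in> E \<Longrightarrow> e \<noteq> g (ends e) \<Longrightarrow> x (ends e, 0) \<le> c e \<and> x (ends e, 1) \<le> c e"
  shows "good_event n ends c E (real (card {i \<in> configs m n C. is_config n r i x}) * r)"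
proof -
  let ?J = "{i \<in> configs m n C. is_config n r i x}"
  let ?F = "g ` {p \<in> mid m r x. fst p \<in> C \<and> snd p \<in> C}"
  let ?ea = "\<lambda>f h (i :: config). g (upair (f i) (h i))"
  let ?a = "\<lambda>(a, b, u, v, w). a" and ?b = "\<lambda>(a, b, u, v, w). b" and ?u = "\<lambda>(a, b, u, v, w). u"
    and ?v = "\<lambda>(a, b, u, v, w). v" and ?w = "\<lambda>(a, b, u, v, w). w"
  have C: "C \<subseteq> {..<m}" "finite C"
    using core finite_subset by (auto simp: is_core_def)
  have low: "p \<in> vpairs n" "x (p, 0) \<le> r" if "p \<in> low m r x" for p
    using that vpairs_mono[OF m] by (auto simp: low_def)
  have mid: "p \<in> vpairs n" "r < x (p, 0)" "x (p, 0) \<le> 2 * r" if "p \<in> mid m r x" for p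
    using that vpairs_mono[OF m] by (auto simp: mid_def)
  have fin: "finite ?J"
    by (rule finite_subset[of _ "{m..<n} \<times> {m..<n} \<times> C \<times> C \<times> C"])
      (use C(2) in \<open>auto simp: configs_def\<close>)
  have J: "a < n" "b < n" "m \<le> a" "m \<le> b" "a \<noteq> b" "u \<in> C" "v \<in> C" "w \<in> C" "v \<noteq> w"
    "u < m" "v < m" "w < m" "u < n" "v < n" "w < n" "a \<noteq> u" "b \<noteq> v" "b \<noteq> w"
    if "(a, b, u, v, w) \<in> ?J" for a b u v w
    using that C(1) m by (force simp: configs_def)+
  interpret local_configurations n ends c E r C ?F ?J ?a ?b ?u ?v ?w
    "?ea ?a ?b" "?ea ?a ?u" "?ea ?b ?v" "?ea ?b ?w"
  proof
    fix e p q assume "e \<in> E" "joins ends e p q"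
    then show "p < n \<and> q < n"
      using joins_vpairs(2,3)[of ends e p q n] E[of e] by simp
  next
    fix y z assume yz: "y \<in> C" "z \<in> C"
    then have conns: "conn id (low m r x) y z" "conn id {p \<in> mid m r x. fst p \<in> C \<and> snd p \<in> C} y z"
      using core by (auto simp: is_core_def)
    show "conn ends {e \<in> E. c e \<le> r} y z"
      by (rule conn_id_image[where g = g, OF conns(1)]) (use low g in auto)
    show "conn ends ?F y z"
      by (rule conn_id_image[where g = g, OF conns(2)]) (use mid g in auto)
  next
    fix e p q assume "e \<in> ?F" "joins ends e p q"
    then show "p \<in> C \<and> q \<in> C"
      using g mid by (auto simp: joins_def)
  next
    fix j e y assume j: "j \<in> ?J" and e: "e \<in> E" "joins ends e (?a j) y"
    obtain a b u v w where j_eq: "j = (a, b, u, v, w)"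
      by (cases j)
    have ends: "ends e = upair a y" "y < n" "y \<noteq> a"
      using joins_vpairs[OF e(2) E[OF e(1)]] by (auto simp: j_eq)
    note j' = j[unfolded j_eq mem_Collect_eq]
    show "e = ?ea ?a ?b j \<or> e = ?ea ?a ?u j \<or> 5 * r < c e"
      using config_at_a[OF conjunct2[OF j'] conjunct1[OF j'] C(1) m, of y]
        config_copies[OF conjunct2[OF j'] conjunct1[OF j'] C(1) m, of "ends e"]
        copies[OF e(1)] g[of "ends e"] E[OF e(1)] ends
      by (cases "e = g (ends e)"; cases "y = b \<or> y = u") (auto simp: j_eq)
  next
    fix j e y assume j: "j \<in> ?J" and e: "e \<in> E" "joins ends e (?b j) y"
    obtain a b u v w where j_eq: "j = (a, b, u, v, w)"
      by (cases j)
    have ends: "ends e = upair b y" "y < n" "y \<noteq> b"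
      using joins_vpairs[OF e(2) E[OF e(1)]] by (auto simp: j_eq)
    have ba: "upair b a = upair a b"
      by (simp add: upair_eq_iff)
    note j' = j[unfolded j_eq mem_Collect_eq]
    show "e = ?ea ?a ?b j \<or> e = ?ea ?b ?v j \<or> e = ?ea ?b ?w j \<or> 5 * r < c e"
      using config_at_b[OF conjunct2[OF j'] conjunct1[OF j'] C(1) m, of y]
        config_copies[OF conjunct2[OF j'] conjunct1[OF j'] C(1) m, of "ends e"]
        copies[OF e(1)] g[of "ends e"] E[OF e(1)] ends ba
      by (cases "e = g (ends e)"; cases "y = a \<or> y = v \<or> y = w") (auto simp: j_eq)
  next
    fix i j assume ij: "i \<in> ?J" "j \<in> ?J" "i \<noteq> j"
    obtain a b u v w where i_eq: "i = (a, b, u, v, w)"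
      by (cases i)
    obtain a' b' u' v' w' where j_eq: "j = (a', b', u', v', w')"
      by (cases j)
    show "{?a i, ?b i} \<inter> {?a j, ?b j} = {}"
      using configs_disjoint[of n r a b u v w x a' b' u' v' w' m C] ij C(1) m r
      by (simp add: i_eq j_eq)
  next
    fix j assume j: "j \<in> ?J"
    obtain a b u v w where j_eq: "j = (a, b, u, v, w)"
      by (cases j)
    note J' = J[OF j[unfolded j_eq]]
    note j' = j[unfolded j_eq mem_Collect_eq]
    note rules = conjunct2[OF j'] conjunct1[OF j'] C(1) m
    have pairs: "upair a b \<in> vpairs n" "upair a u \<in> vpairs n" "upair b v \<in> vpairs n" "upair b w \<in> vpairs n"
      using J' by (simp_all add: upair_in_vpairs)
    note gs = g[OF pairs(1)] g[OF pairs(2)] g[OF pairs(3)] g[OF pairs(4)]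
    show "?a j < n \<and> ?b j < n" "?a j \<notin> C \<and> ?b j \<notin> C" "?a j \<noteq> ?b j"
      "?u j \<in> C \<and> ?v j \<in> C \<and> ?w j \<in> C" "?v j \<noteq> ?w j"
      using J' C(1) by (auto simp: j_eq)
    show "?ea ?a ?b j \<in> E \<and> ?ea ?a ?u j \<in> E \<and> ?ea ?b ?v j \<in> E \<and> ?ea ?b ?w j \<in> E"
      using gs by (simp add: j_eq)
    show "joins ends (?ea ?a ?b j) (?a j) (?b j)" "joins ends (?ea ?a ?u j) (?a j) (?u j)"
      "joins ends (?ea ?b ?v j) (?b j) (?v j)" "joins ends (?ea ?b ?w j) (?b j) (?w j)"
      using gs by (simp_all add: j_eq joins_upair)
    show "c (?ea ?a ?b j) \<le> r" "c (?ea ?a ?u j) \<le> r"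
      "2 * r < c (?ea ?b ?v j) \<and> c (?ea ?b ?v j) \<le> 4 * r"
      "2 * r < c (?ea ?b ?w j) \<and> c (?ea ?b ?w j) \<le> 4 * r"
      using config_ab[OF rules] config_au[OF rules] config_bv[OF rules] config_bw[OF rules] gs r
      by (simp_all add: j_eq)
  next
    show "finite ?F"
      by (intro finite_imageI finite_subset[OF _ finite_vpairs[of m]]) (auto simp: mid_def)
  next
    show "?F \<subseteq> E"
      using g mid(1) by auto
  next
    fix e assume "e \<in> ?F"
    then obtain p where "p \<in> mid m r x" "e = g p"
      by auto
    then show "r < c e \<and> c e \<le> 2 * r"
      using g[of p] mid[of p] by simp
  next
    fix y assume "y \<in> C"
    then show "y < n"
      using C(1) m by auto
  qed (simp_all add: c r fin)
  show ?thesis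
    by (rule good_event_configurations)
qed

section \<open>Existence of the core\<close>

definition expanding :: "nat \<Rightarrow> nat \<Rightarrow> real set \<Rightarrow> ((nat \<times> nat) \<times> nat \<Rightarrow> real) \<Rightarrow> bool" where
  "expanding m k W x \<longleftrightarrow> (\<forall>X\<subseteq>{..<m}. \<forall>Y\<subseteq>{..<m}. X \<inter> Y = {} \<longrightarrow> k \<le> card X \<longrightarrow> k \<le> card Y \<longrightarrow>
     (\<exists>a\<in>X. \<exists>b\<in>Y. x (upair a b, 0) \<in> W))"

text \<open>\<open>giant_component\<close> is applied twice, to the low edges on all of
  \<open>{..<m}\<close> and then to the middle edges inside the component found. Each round loses
  fewer than \<open>k\<close> vertices, so at least \<open>2 * k\<close> of the initial
  \<open>4 * k\<close> remain.\<close>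

lemma core_exists:
  assumes "expanding m k {..r} x" "expanding m k {r<..2 * r} x" "0 < k" "4 * k \<le> m"
  obtains C where "is_core m (low m r x) (mid m r x) C" "2 * k \<le> card C"
proof -
  have step: "\<exists>e\<in>{p \<in> vpairs m. x (p, 0) \<in> W}. \<exists>a\<in>X. \<exists>b\<in>Y. joins id e a b"
    if "expanding m k W x" "X \<subseteq> {..<m}" "Y \<subseteq> {..<m}" "X \<inter> Y = {}" "k \<le> card X" "k \<le> card Y" for W X Y
  proof -
    have "\<exists>a\<in>X. \<exists>b\<in>Y. x (upair a b, 0) \<in> W"
      using that unfolding expanding_def by blast
    then obtain a b where ab: "a \<in> X" "b \<in> Y" "x (upair a b, 0) \<in> W"
      by blast
    then have "upair a b \<in> vpairs m"
      using that by (auto simp: upair_in_vpairs)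
    then show ?thesis
      using ab by (intro bexI[of _ "upair a b"] bexI[of _ a] bexI[of _ b] joins_upair) auto
  qed
  have low: "low m r x = {p \<in> vpairs m. x (p, 0) \<in> {..r}}"
    and mid: "mid m r x = {p \<in> vpairs m. x (p, 0) \<in> {r<..2 * r}}"
    by (auto simp: low_def mid_def)
  obtain C1 where C1: "C1 \<subseteq> {..<m}" "m < card C1 + k"
    "\<And>a b. a \<in> C1 \<Longrightarrow> b \<in> C1 \<Longrightarrow> conn id {e \<in> low m r x. fst (id e) \<in> C1 \<and> snd (id e) \<in> C1} a b"
    by (rule giant_component[of "{..<m}" k "low m r x" id])
      (use assms(3,4) step[OF assms(1)] in \<open>auto simp: low\<close>)
  have "finite C1"
    using C1(1) finite_subset by blast
  obtain C where C: "C \<subseteq> C1" "card C1 < card C + k"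
    "\<And>a b. a \<in> C \<Longrightarrow> b \<in> C \<Longrightarrow> conn id {e \<in> mid m r x. fst (id e) \<in> C \<and> snd (id e) \<in> C} a b"
  proof (rule giant_component[of C1 k "mid m r x" id])
    show "3 * k \<le> card C1"
      using C1(2) assms(4) by simp
    show "\<exists>e\<in>mid m r x. \<exists>a\<in>X. \<exists>b\<in>Y. joins id e a b"
      if "X \<subseteq> C1" "Y \<subseteq> C1" "X \<inter> Y = {}" "k \<le> card X" "k \<le> card Y" for X Y
      unfolding mid using that C1(1) by (intro step[OF assms(2)]) auto
  qed (use assms(3) \<open>finite C1\<close> in auto)
  have "conn id (low m r x) a b" if "a \<in> C" "b \<in> C" for a b
    by (rule conn_mono[OF C1(3)]) (use that C(1) in auto)
  then have "is_core m (low m r x) (mid m r x) C"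
    using C(1,3) C1(1) by (auto simp: is_core_def)
  moreover have "2 * k \<le> card C"
    using C(2) C1(2) assms(4) by simp
  ultimately show ?thesis
    by (rule that)
qed

section \<open>Counting configurations\<close>

lemma card_configs:
  assumes "finite C"
  shows "card (configs m n C) = (n - m) * (n - m - 1) * card C * card C * (card C - 1)"
proof -
  have "configs m n C = (SIGMA a:{m..<n}. SIGMA b:{m..<n} - {a}. C \<times> (SIGMA v:C. C - {v}))"
    by (auto simp: configs_def)
  then show ?thesis
    using assms by (simp add: card_Diff_subset mult.assoc)
qed

lemma finite_configs: "finite C \<Longrightarrow> finite (configs m n C)"
  by (rule finite_subset[of _ "{m..<n} \<times> {m..<n} \<times> C \<times> C \<times> C"]) (auto simp: configs_def)

lemma card_star_le: "card (star n a b) \<le> 2 * n"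
proof -
  have "star n a b \<subseteq> upair a ` {..<n} \<union> upair b ` {..<n}"
  proof
    fix p assume p: "p \<in> star n a b"
    then have "p \<in> {upair a (fst p), upair a (snd p), upair b (fst p), upair b (snd p)}"
      "fst p < n" "snd p < n"
      by (auto simp: star_def vpairs_def upair_def min_def max_def)
    then show "p \<in> upair a ` {..<n} \<union> upair b ` {..<n}"
      by auto
  qed
  then have "card (star n a b) \<le> card (upair a ` {..<n} \<union> upair b ` {..<n})"
    by (intro card_mono) auto
  also have "\<dots> \<le> card (upair a ` {..<n}) + card (upair b ` {..<n})"
    by (rule card_Un_le)
  also have "\<dots> \<le> card {..<n} + card {..<n}"
    by (intro add_mono card_image_le) auto
  finally show ?thesis
    by simp
qed

lemma finite_star: "finite (star n a b)"
  by (rule finite_subset[OF _ finite_vpairs[of n]]) (auto simp: star_def)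

lemma finite_coords: "finite (coords n i)"
  by (cases i) (simp add: finite_star)

lemma coords_subset:
  assumes "i \<in> configs m n C" "C \<subseteq> {..<m}" "m \<le> n"
  shows "coords n i \<subseteq> vpairs n \<times> UNIV"
proof -
  obtain a b u v w where i: "i = (a, b, u, v, w)"
    by (cases i)
  have "a < n" "b < n" "m \<le> a" "m \<le> b" "a \<noteq> b" "u < m" "v < m" "w < m"
    using assms by (auto simp: configs_def i)
  then show ?thesis
    using assms(3) by (auto simp: i upair_in_vpairs) (auto simp: star_def)
qed

text \<open>Each coordinate of a configuration belongs to a pair meeting \<open>{a, b}\<close>, and
  these vertices are at least \<open>m\<close>. So configurations are independent of the edge
  patterns on \<open>{..<m}\<close>.\<close>

lemma coords_outside:
  assumes "i \<in> configs m n C" "C \<subseteq> {..<m}" "m \<le> n"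
  shows "vpairs m \<times> {0} \<inter> coords n i = {}"
proof -
  obtain a b u v w where i: "i = (a, b, u, v, w)"
    by (cases i)
  have "m \<le> a" "m \<le> b"
    using assms by (auto simp: configs_def i)
  then show ?thesis
    by (auto simp: i star_def vpairs_def)
qed

text \<open>The attachment vertices lie below \<open>m\<close>, so two vertex-disjoint
  configurations share only the four pairs between \<open>{a, b}\<close> and
  \<open>{a', b'}\<close>. Both require these pairs to be expensive.\<close>

lemma coords_Int:
  assumes i: "(a, b, u, v, w) \<in> configs m n C" and j: "(a', b', u', v', w') \<in> configs m n C"
    and C: "C \<subseteq> {..<m}" "m \<le> n" and disj: "{a, b} \<inter> {a', b'} = {}"
  shows "coords n (a, b, u, v, w) \<inter> coords n (a', b', u', v', w')
      \<subseteq> {upair a a', upair a b', upair b a', upair b b'} \<times> {0}"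
    and "t \<in> coords n (a, b, u, v, w) \<Longrightarrow> t \<in> coords n (a', b', u', v', w') \<Longrightarrow>
      window r (a', b', u', v', w') t = {5 * r<..}"
proof -
  have ab: "a \<noteq> b" "m \<le> a" "m \<le> b" "a' \<noteq> b'" "m \<le> a'" "m \<le> b'"
    using i j by (auto simp: configs_def)
  have uvw: "u < m" "v < m" "w < m" "u' < m" "v' < m" "w' < m"
    using i j C by (auto simp: configs_def)
  have ne: "a \<noteq> a'" "a \<noteq> b'" "b \<noteq> a'" "b \<noteq> b'"
    using disj by auto
  have star: "p \<in> {upair a a', upair a b', upair b a', upair b b'}"
    if p_star: "p \<in> star n a b" "p \<in> star n a' b'" for p
  proof -
    obtain y z where p: "p = (y, z)" "y < z"
      using p_star(1) by (auto simp: star_def vpairs_def)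
    then have yz: "p = upair y z" "p = upair z y"
      by (auto simp: upair_def)
    have "y \<in> {a, b} \<and> z \<in> {a', b'} \<or> z \<in> {a, b} \<and> y \<in> {a', b'}"
      using p_star ne p by (auto simp: star_def)
    then show ?thesis
      using yz by (elim disjE conjE) auto
  qed
  have special: "upair y z \<noteq> upair y' z'"
    if "y = a \<or> y = b" "y' = a' \<or> y' = b'" "z' = b' \<or> z' = u' \<or> z' = v' \<or> z' = w'" for y z y' z'
    using that ab uvw ne unfolding upair_eq_iff by (metis leD)
  have "{upair a b, upair a u, upair b v, upair b w} \<inter> {upair a' b', upair a' u', upair b' v', upair b' w'} = {}"
    by (simp add: special)
  with star show sub: "coords n (a, b, u, v, w) \<inter> coords n (a', b', u', v', w')
      \<subseteq> {upair a a', upair a b', upair b a', upair b b'} \<times> {0}"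
    by auto
  assume "t \<in> coords n (a, b, u, v, w)" "t \<in> coords n (a', b', u', v', w')"
  then have "t \<in> {upair a a', upair a b', upair b a', upair b b'} \<times> {0}"
    using sub by blast
  then obtain y z where "t = (upair y z, 0)" "y = a \<or> y = b"
    by auto
  then show "window r (a', b', u', v', w') t = {5 * r<..}"
    by (simp add: special)
qed

section \<open>Probability estimates\<close>

fun cell :: "real \<Rightarrow> (nat \<times> nat) set \<Rightarrow> (nat \<times> nat) set \<Rightarrow> (nat \<times> nat) \<times> nat \<Rightarrow> real set" where
  "cell r L D (p, k) = (if p \<in> L then {..r} else if p \<in> D then {r<..2 * r} else {2 * r<..})"

text \<open>What the exponential and uniform laws have in common near 0: an interval in
  \<open>[0, 1 / 2]\<close> has probability comparable to its length. The case \<open>t = 0\<close>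
  of \<open>upper\<close> also makes costs positive almost surely.\<close>

locale edge_law = prob_space Q for Q :: "real measure" +
  assumes sets_Q [simp]: "sets Q = sets borel"
    and upper: "0 \<le> t \<Longrightarrow> prob {..t} \<le> t"
    and lower: "0 \<le> s \<Longrightarrow> s \<le> t \<Longrightarrow> t \<le> 1 / 2 \<Longrightarrow> (t - s) / 2 \<le> prob {s<..t}"
begin

lemma space_Q [simp]: "space Q = UNIV"
  using sets_eq_imp_space_eq[OF sets_Q] by simp

text \<open>One space with infinitely many coordinates per pair serves all models; the simple-graph
  models are its marginals on the coordinates \<open>(p, 0)\<close>.\<close>

definition model :: "nat \<Rightarrow> (((nat \<times> nat) \<times> nat) \<Rightarrow> real) measure" where
  "model n = PiM (vpairs n \<times> UNIV) (\<lambda>_. Q)"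

definition cyl :: "nat \<Rightarrow> ((nat \<times> nat) \<times> nat) set \<Rightarrow> ((nat \<times> nat) \<times> nat \<Rightarrow> real set) \<Rightarrow>
    ((nat \<times> nat) \<times> nat \<Rightarrow> real) set" where
  "cyl n J X = {x \<in> space (model n). \<forall>t\<in>J. x t \<in> X t}"

lemma prob_space_model: "prob_space (model n)"
  unfolding model_def by (intro prob_space_PiM) unfold_locales

lemma
  assumes "J \<subseteq> vpairs n \<times> UNIV" "finite J" "\<And>t. t \<in> J \<Longrightarrow> X t \<in> sets borel"
  shows sets_cyl: "cyl n J X \<in> sets (model n)"
    and measure_cyl: "measure (model n) (cyl n J X) = (\<Prod>t\<in>J. prob (X t))"
  using assms sets_cylinder[OF prob_space_axioms, of J _ X] measure_cylinder[OF prob_space_axioms, of J _ X]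
  by (simp_all add: cyl_def model_def)

lemma cyl_Int:
  "J \<inter> J' = {} \<Longrightarrow> cyl n J X \<inter> cyl n J' X' = cyl n (J \<union> J') (\<lambda>t. if t \<in> J then X t else X' t)"
  by (auto simp: cyl_def)

lemma measure_cyl_Int:
  assumes "J \<subseteq> vpairs n \<times> UNIV" "finite J" "\<And>t. t \<in> J \<Longrightarrow> X t \<in> sets borel"
    and "J' \<subseteq> vpairs n \<times> UNIV" "finite J'" "\<And>t. t \<in> J' \<Longrightarrow> X' t \<in> sets borel" "J \<inter> J' = {}"
  shows "measure (model n) (cyl n J X \<inter> cyl n J' X') =
    measure (model n) (cyl n J X) * measure (model n) (cyl n J' X')"
  using assms measure_cylinder_Int[OF prob_space_axioms, of J "vpairs n \<times> UNIV" X J' X']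
  by (simp add: cyl_def model_def)

text \<open>Disjointness of \<open>X\<close> and \<open>Y\<close> makes their pairs distinct, so at
  least \<open>k * k\<close> independent coordinates must avoid \<open>W\<close>; then
  \<open>1 - q \<le> exp (- q)\<close>.\<close>

lemma
  assumes XY: "X \<subseteq> {..<m}" "Y \<subseteq> {..<m}" "X \<inter> Y = {}" "k \<le> card X" "k \<le> card Y" and "m \<le> n"
    and W: "W \<in> sets borel" "q \<le> prob W" "0 \<le> q"
  shows sets_no_edge: "{x \<in> space (model n). \<forall>a\<in>X. \<forall>b\<in>Y. x (upair a b, 0) \<notin> W} \<in> sets (model n)"
    and prob_no_edge_le: "measure (model n) {x \<in> space (model n). \<forall>a\<in>X. \<forall>b\<in>Y. x (upair a b, 0) \<notin> W}
      \<le> exp (- q * (real k)\<^sup>2)"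
proof -
  let ?J = "(\<lambda>(a, b). (upair a b, 0 :: nat)) ` (X \<times> Y)"
  have fin: "finite X" "finite Y"
    using XY finite_subset by blast+
  have eq: "{x \<in> space (model n). \<forall>a\<in>X. \<forall>b\<in>Y. x (upair a b, 0) \<notin> W} = cyl n ?J (\<lambda>_. - W)"
    by (auto simp: cyl_def)
  have J: "?J \<subseteq> vpairs n \<times> UNIV"
    using XY \<open>m \<le> n\<close> by (force simp: upair_in_vpairs)
  show "{x \<in> space (model n). \<forall>a\<in>X. \<forall>b\<in>Y. x (upair a b, 0) \<notin> W} \<in> sets (model n)"
    unfolding eq using J fin W by (intro sets_cyl) auto
  have inj: "inj_on (\<lambda>(a, b). (upair a b, 0 :: nat)) (X \<times> Y)"
    using XY(3) by (auto simp: inj_on_def upair_eq_iff)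
  have "measure (model n) (cyl n ?J (\<lambda>_. - W)) = (\<Prod>t\<in>?J. prob (- W))"
    using J fin W by (intro measure_cyl) auto
  also have "\<dots> = prob (- W) ^ (card X * card Y)"
    using inj by (simp add: card_image card_cartesian_product)
  also have "prob (- W) = 1 - prob W"
    using prob_compl[of W] W by (simp add: Compl_eq_Diff_UNIV)
  also have "(1 - prob W) ^ (card X * card Y) \<le> (1 - prob W) ^ (k * k)"
    using XY(4,5) by (intro power_decreasing mult_le_mono) auto
  also have "\<dots> \<le> exp (- q) ^ (k * k)"
  proof (rule power_mono)
    have "1 - prob W \<le> 1 - q"
      using W by simp
    also have "\<dots> \<le> exp (- q)"
      using exp_ge_add_one_self[of "- q"] by simp
    finally show "1 - prob W \<le> exp (- q)" .
  qed simp
  also have "\<dots> = exp (- q * (real k)\<^sup>2)"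
    by (simp add: exp_of_nat_mult[symmetric] power2_eq_square algebra_simps)
  finally show "measure (model n) {x \<in> space (model n). \<forall>a\<in>X. \<forall>b\<in>Y. x (upair a b, 0) \<notin> W}
      \<le> exp (- q * (real k)\<^sup>2)"
    unfolding eq .
qed

text \<open>A union bound over the at most \<open>4 ^ m\<close> choices of
  \<open>(X, Y)\<close>.\<close>

lemma
  assumes "m \<le> n" and W: "W \<in> sets borel" "q \<le> prob W" "0 \<le> q"
  shows sets_not_expanding: "{x \<in> space (model n). \<not> expanding m k W x} \<in> sets (model n)"
    and prob_not_expanding_le: "measure (model n) {x \<in> space (model n). \<not> expanding m k W x}
      \<le> 4 ^ m * exp (- q * (real k)\<^sup>2)"
proof -
  interpret M: prob_space "model n"
    by (rule prob_space_model)
  let ?S = "{(X, Y). X \<subseteq> {..<m} \<and> Y \<subseteq> {..<m} \<and> X \<inter> Y = {} \<and> k \<le> card X \<and> k \<le> card Y}"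
  let ?N = "\<lambda>(X, Y). {x \<in> space (model n). \<forall>a\<in>X. \<forall>b\<in>Y. x (upair a b, 0) \<notin> W}"
  have S: "?S \<subseteq> Pow {..<m} \<times> Pow {..<m}"
    by auto
  have fin: "finite ?S"
    by (rule finite_subset[OF S]) simp
  have eq: "{x \<in> space (model n). \<not> expanding m k W x} = (\<Union>s\<in>?S. ?N s)"
    unfolding expanding_def by auto
  have sets: "?N s \<in> sets (model n)" if "s \<in> ?S" for s
    using that sets_no_edge[OF _ _ _ _ _ \<open>m \<le> n\<close> W] by auto
  show "{x \<in> space (model n). \<not> expanding m k W x} \<in> sets (model n)"
    unfolding eq using fin sets by (rule sets.finite_UN)
  have "measure (model n) (\<Union>s\<in>?S. ?N s) \<le> (\<Sum>s\<in>?S. measure (model n) (?N s))"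
    using fin sets by (intro M.finite_measure_subadditive_finite) auto
  also have "\<dots> \<le> (\<Sum>s\<in>?S. exp (- q * (real k)\<^sup>2))"
    using prob_no_edge_le[OF _ _ _ _ _ \<open>m \<le> n\<close> W] by (intro sum_mono) auto
  also have "\<dots> = real (card ?S) * exp (- q * (real k)\<^sup>2)"
    by simp
  also have "\<dots> \<le> 4 ^ m * exp (- q * (real k)\<^sup>2)"
  proof (rule mult_right_mono)
    have "card ?S \<le> card (Pow {..<m} \<times> Pow {..<m})"
      by (intro card_mono S) simp
    also have "\<dots> = 4 ^ m"
      by (simp add: card_cartesian_product card_Pow power_mult_distrib[symmetric])
    finally have "real (card ?S) \<le> real (4 ^ m)"
      by (rule of_nat_mono)
    then show "real (card ?S) \<le> 4 ^ m"
      by simp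
  qed simp
  finally show "measure (model n) {x \<in> space (model n). \<not> expanding m k W x}
      \<le> 4 ^ m * exp (- q * (real k)\<^sup>2)"
    unfolding eq .
qed

text \<open>Fixing both edge patterns on \<open>{..<m}\<close> is a cylinder event. This replaces
  conditioning on the first half of the vertices by a finite partition into cylinders.\<close>

lemma cells:
  assumes "L \<subseteq> vpairs m" "D \<subseteq> vpairs m" "L \<inter> D = {}" "0 < r"
  shows "{x \<in> space (model n). low m r x = L \<and> mid m r x = D} = cyl n (vpairs m \<times> {0}) (cell r L D)"
proof -
  have "low m r x = L \<and> mid m r x = D \<longleftrightarrow> (\<forall>t\<in>vpairs m \<times> {0}. x t \<in> cell r L D t)" for x
  proof -
    have "low m r x = L \<longleftrightarrow> (\<forall>p\<in>vpairs m. p \<in> L \<longleftrightarrow> x (p, 0) \<le> r)"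
      using assms(1) by (auto simp: low_def)
    moreover have "mid m r x = D \<longleftrightarrow> (\<forall>p\<in>vpairs m. p \<in> D \<longleftrightarrow> r < x (p, 0) \<and> x (p, 0) \<le> 2 * r)"
      using assms(2) by (auto simp: mid_def)
    moreover have "(p \<in> L \<longleftrightarrow> x (p, 0) \<le> r) \<and> (p \<in> D \<longleftrightarrow> r < x (p, 0) \<and> x (p, 0) \<le> 2 * r) \<longleftrightarrow>
      x (p, 0) \<in> cell r L D (p, 0)" for p
      using assms(3,4) by auto
    ultimately have "low m r x = L \<and> mid m r x = D \<longleftrightarrow> (\<forall>p\<in>vpairs m. x (p, 0) \<in> cell r L D (p, 0))"
      by (simp only: ball_conj_distrib[symmetric])
    also have "\<dots> \<longleftrightarrow> (\<forall>t\<in>vpairs m \<times> {0}. x t \<in> cell r L D t)"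
      by blast
    finally show ?thesis .
  qed
  then show ?thesis
    by (simp add: cyl_def)
qed

lemma sets_cell: "cell r L D t \<in> sets borel"
  by (cases t) simp

lemma sets_window: "window r i t \<in> sets borel"
  by (cases i) simp

lemma expensive_prob:
  assumes "0 \<le> r"
  shows "1 - 5 * r \<le> prob {5 * r<..}"
proof -
  have "prob {5 * r<..} = 1 - prob {..5 * r}"
    using prob_compl[of "{..5 * r}"] by (simp add: Compl_eq_Diff_UNIV[symmetric])
  then show ?thesis
    using upper[of "5 * r"] assms by simp
qed

text \<open>Four coordinates have windows of probability at least \<open>r / 2\<close>, since
  \<open>8 * r \<le> 1\<close> keeps all endpoints up to \<open>4 * r\<close> below
  \<open>1 / 2\<close>. The remaining coordinates only have to be expensive.\<close>

lemma config_prob_ge: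
  assumes i: "i \<in> configs m n C" and C: "C \<subseteq> {..<m}" "m \<le> n" and r: "0 < r" "8 * r \<le> 1"
  shows "(r / 2) ^ 4 * prob {5 * r<..} ^ (2 * n) \<le> measure (model n) (cyl n (coords n i) (window r i))"
proof -
  let ?h = "prob {5 * r<..}"
  obtain a b u v w where i_eq: "i = (a, b, u, v, w)"
    by (cases i)
  have ab: "a < n" "b < n" "m \<le> a" "m \<le> b" "a \<noteq> b" "u < m" "v < m" "w < m" "v \<noteq> w"
    using i C by (auto simp: configs_def i_eq)
  define S where "S = {upair a b, upair a u, upair b v, upair b w}"
  have S_star: "S \<subseteq> star n a b"
    using ab \<open>m \<le> n\<close> by (auto simp: S_def upair_in_star)
  have ne: "upair a b \<noteq> upair a u" "upair a b \<noteq> upair b v" "upair a b \<noteq> upair b w"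
    "upair a u \<noteq> upair b v" "upair a u \<noteq> upair b w" "upair b v \<noteq> upair b w"
    using ab by (auto simp: upair_eq_iff)
  then have card_S: "card S = 4"
    by (simp add: S_def)
  have coords: "coords n i = S \<times> {0} \<union> ((star n a b - S) \<times> {0} \<union> S \<times> {1})"
    using S_star by (auto simp: i_eq S_def)
  have fin: "finite S" "finite (star n a b)"
    by (simp_all add: S_def finite_star)
  have "measure (model n) (cyl n (coords n i) (window r i)) = (\<Prod>t\<in>coords n i. prob (window r i t))"
    using coords_subset[OF i C] by (intro measure_cyl finite_coords sets_window)
  also have "\<dots> = (\<Prod>t\<in>S \<times> {0}. prob (window r i t)) *
      (\<Prod>t\<in>(star n a b - S) \<times> {0} \<union> S \<times> {1}. prob (window r i t))"
    unfolding coords using fin by (intro prod.union_disjoint) auto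
  also have "(\<Prod>t\<in>(star n a b - S) \<times> {0} \<union> S \<times> {1}. prob (window r i t)) =
      (\<Prod>t\<in>(star n a b - S) \<times> {0 :: nat} \<union> S \<times> {1}. ?h)"
    by (rule prod.cong) (auto simp: i_eq S_def)
  also have "\<dots> = ?h ^ card ((star n a b - S) \<times> {0 :: nat} \<union> S \<times> {1})"
    by simp
  also have "S \<times> {0 :: nat} = {(upair a b, 0), (upair a u, 0), (upair b v, 0), (upair b w, 0)}"
    by (auto simp: S_def)
  also have "(\<Prod>t\<in>{(upair a b, 0 :: nat), (upair a u, 0), (upair b v, 0), (upair b w, 0)}. prob (window r i t)) =
      prob {..r} * prob {..r} * prob {2 * r<..3 * r} * prob {3 * r<..4 * r}"
    using ne by (simp add: i_eq)
  finally have eq: "measure (model n) (cyl n (coords n i) (window r i)) =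
      prob {..r} * prob {..r} * prob {2 * r<..3 * r} * prob {3 * r<..4 * r} *
      ?h ^ card ((star n a b - S) \<times> {0 :: nat} \<union> S \<times> {1})" .
  \<comment> \<open>The four second interarrival times exactly replace the four cheap pairs in the
    count, so the exponent is the size of the star.\<close>
  have "card ((star n a b - S) \<times> {0 :: nat} \<union> S \<times> {1}) = card (star n a b - S) + 4"
    using fin card_S by (subst card_Un_disjoint) auto
  also have "\<dots> = card (star n a b)"
    using card_Diff_subset[OF fin(1) S_star] card_mono[OF fin(2) S_star] card_S by simp
  also have "\<dots> \<le> 2 * n"
    by (rule card_star_le)
  finally have h: "?h ^ (2 * n) \<le> ?h ^ card ((star n a b - S) \<times> {0 :: nat} \<union> S \<times> {1})"
    by (intro power_decreasing) auto
  have "r / 2 \<le> prob {0<..r}"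
    using lower[of 0 r] r by simp
  also have "\<dots> \<le> prob {..r}"
    by (intro finite_measure_mono) auto
  finally have "r / 2 * (r / 2) * (r / 2) * (r / 2) \<le>
      prob {..r} * prob {..r} * prob {2 * r<..3 * r} * prob {3 * r<..4 * r}"
    using lower[of "2 * r" "3 * r"] lower[of "3 * r" "4 * r"] r by (intro mult_mono) auto
  then show ?thesis
    unfolding eq using h r by (intro mult_mono) (auto simp: power4_eq_xxxx)
qed

text \<open>Configurations sharing a vertex exclude each other. Otherwise at most four coordinates
  are shared, each with an expensive window, so the deviation from independence is at most a factor
  \<open>1 / prob {5 * r<..} ^ 4\<close>.\<close>

lemma config_pair_prob_le:
  assumes i: "i \<in> configs m n C" and j: "j \<in> configs m n C" and "i \<noteq> j"
    and C: "C \<subseteq> {..<m}" "m \<le> n" and r: "0 < r" "0 < prob {5 * r<..}"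
    and D: "D = cyl n (vpairs m \<times> {0}) (cell r L L')"
  defines "A \<equiv> \<lambda>i. cyl n (coords n i) (window r i)"
  shows "measure (model n) (D \<inter> (A i \<inter> A j)) \<le> measure (model n) D *
    (1 / prob {5 * r<..} ^ 4 * measure (model n) (A i) * measure (model n) (A j))"
proof -
  interpret M: prob_space "model n"
    by (rule prob_space_model)
  let ?h = "prob {5 * r<..}"
  obtain a b u v w where i_eq: "i = (a, b, u, v, w)"
    by (cases i)
  obtain a' b' u' v' w' where j_eq: "j = (a', b', u', v', w')"
    by (cases j)
  note ij = i[unfolded i_eq] j[unfolded j_eq]
  show ?thesis
  proof (cases "{a, b} \<inter> {a', b'} = {}")
    case False
    then have "A i \<inter> A j = {}"
      using configs_disjoint[OF _ _ ij C r(1)] \<open>i \<noteq> j\<close>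
      by (auto simp: A_def cyl_def is_config_def i_eq j_eq simp del: coords.simps window.simps)
    then show ?thesis
      by simp
  next
    case True
    define V where "V = vpairs m \<times> {0 :: nat}"
    define I J where "I = coords n i" and "J = coords n j"
    let ?B = "cyl n (J - I) (window r j)"
    have sub: "I \<subseteq> vpairs n \<times> UNIV" "J \<subseteq> vpairs n \<times> UNIV" "V \<subseteq> vpairs n \<times> UNIV"
      using coords_subset[OF i C] coords_subset[OF j C] vpairs_mono[OF \<open>m \<le> n\<close>]
      by (auto simp: I_def J_def V_def)
    have "V \<inter> I = {}" "V \<inter> J = {}"
      using coords_outside[OF i C] coords_outside[OF j C] by (simp_all only: I_def J_def V_def)
    then have V: "V \<inter> I = {}" "(V \<union> I) \<inter> (J - I) = {}"
      by blast+
    have fin: "finite I" "finite J" "finite V"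
      by (simp_all add: finite_coords finite_vpairs I_def J_def V_def)
    have D: "D = cyl n V (cell r L L')"
      by (simp add: D V_def)
    have A: "A i = cyl n I (window r i)" "A j = cyl n J (window r j)"
      by (simp_all add: A_def I_def J_def)
    have sets: "D \<in> sets (model n)" "A i \<in> sets (model n)" "?B \<in> sets (model n)"
      unfolding D A using sub fin by (auto intro!: sets_cyl sets_cell sets_window)
    \<comment> \<open>Forgetting the shared coordinates enlarges \<open>A j\<close> to an event
      independent of \<open>D \<inter> A i\<close>.\<close>
    have "A j \<subseteq> ?B"
      by (auto simp: A cyl_def)
    then have "measure (model n) (D \<inter> (A i \<inter> A j)) \<le> measure (model n) (D \<inter> A i \<inter> ?B)"
      using sets by (intro M.finite_measure_mono sets.Int) auto
    also have "\<dots> = measure (model n) (D \<inter> A i) * measure (model n) ?B"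
      unfolding D A cyl_Int[OF V(1)] using sub fin V(2)
      by (intro measure_cyl_Int) (auto simp: sets_cell sets_window)
    also have "measure (model n) (D \<inter> A i) = measure (model n) D * measure (model n) (A i)"
      unfolding D A using sub V fin by (intro measure_cyl_Int sets_cell sets_window)
    finally have le: "measure (model n) (D \<inter> (A i \<inter> A j)) \<le>
      measure (model n) D * measure (model n) (A i) * measure (model n) ?B" .
    have "card (I \<inter> J) \<le> card ({upair a a', upair a b', upair b a', upair b b'} \<times> {0 :: nat})"
      using coords_Int(1)[OF ij C True] unfolding I_def J_def i_eq j_eq by (intro card_mono) simp_all
    also have "\<dots> \<le> 4"
      by (simp add: card_cartesian_product card_insert_if)
    finally have card: "card (I \<inter> J) \<le> 4" .
    have "measure (model n) (A j) = (\<Prod>t\<in>(J - I) \<union> (I \<inter> J). prob (window r j t))"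
      unfolding A using sub fin
      by (subst measure_cyl) (auto simp: sets_window intro!: prod.cong)
    also have "\<dots> = (\<Prod>t\<in>J - I. prob (window r j t)) * (\<Prod>t\<in>I \<inter> J. prob (window r j t))"
      using fin by (intro prod.union_disjoint) auto
    also have "(\<Prod>t\<in>J - I. prob (window r j t)) = measure (model n) ?B"
      using sub fin by (subst measure_cyl) (auto simp: sets_window)
    also have "(\<Prod>t\<in>I \<inter> J. prob (window r j t)) = (\<Prod>t\<in>I \<inter> J. ?h)"
      using coords_Int(2)[OF ij C True] unfolding I_def J_def i_eq j_eq
      by (intro prod.cong) (simp_all del: coords.simps window.simps)
    also have "\<dots> = ?h ^ card (I \<inter> J)"
      by simp
    finally have "measure (model n) ?B * ?h ^ card (I \<inter> J) = measure (model n) (A j)" ..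
    moreover have "?h ^ 4 \<le> ?h ^ card (I \<inter> J)"
      using card by (intro power_decreasing) auto
    ultimately have "measure (model n) ?B * ?h ^ 4 \<le> measure (model n) (A j)"
      by (metis measure_nonneg mult_left_mono)
    then have "measure (model n) ?B \<le> measure (model n) (A j) / ?h ^ 4"
      using r(2) by (simp add: pos_le_divide_eq)
    then have "measure (model n) D * measure (model n) (A i) * measure (model n) ?B \<le>
      measure (model n) D * measure (model n) (A i) * (measure (model n) (A j) / ?h ^ 4)"
      by (intro mult_left_mono) auto
    with le show ?thesis
      by (simp add: mult.assoc mult.left_commute)
  qed
qed

end

section \<open>Conditioning on the edge patterns of the first half\<close>

context edge_law
begin

text \<open>The exceptional set consists of the two failures of expansion and, for each pattern that
  has a large core, the part of its cell with too few configurations. The cells are disjoint, so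
  their second moment errors add up to at most one such error.\<close>

lemma core_with_configs:
  assumes m: "m \<le> n" "0 < k" "4 * k \<le> m" and r: "0 < r" "8 * r \<le> 1"
    and h: "h = prob {5 * r<..}" and "0 < \<mu>\<^sub>0"
    and \<mu>\<^sub>0: "\<And>C. C \<subseteq> {..<m} \<Longrightarrow> 2 * k \<le> card C \<Longrightarrow>
      \<mu>\<^sub>0 \<le> real (card (configs m n C)) * ((r / 2) ^ 4 * h ^ (2 * n))"
  obtains B where "B \<in> sets (model n)"
    and "measure (model n) B \<le> 2 * 4 ^ m * exp (- (r / 2) * (real k)\<^sup>2) + 4 * (1 / \<mu>\<^sub>0 + 1 / h ^ 4 - 1)"
    and "\<And>x. x \<in> space (model n) - B \<Longrightarrow> \<exists>C. is_core m (low m r x) (mid m r x) C \<and>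
      \<mu>\<^sub>0 / 2 \<le> real (card {i \<in> configs m n C. is_config n r i x})"
proof -
  interpret M: prob_space "model n"
    by (rule prob_space_model)
  have h_pos: "0 < h" "h \<le> 1"
    using expensive_prob[of r] r by (auto simp: h)
  define \<D> where "\<D> = {(L, D). L \<subseteq> vpairs m \<and> D \<subseteq> vpairs m \<and> L \<inter> D = {} \<and>
    (\<exists>C. is_core m L D C \<and> 2 * k \<le> card C)}"
  \<comment> \<open>The chosen core depends only on the pattern and is therefore a fixed set on each
    cell, as the second moment bound requires.\<close>
  define K where "K = (\<lambda>(L, D). SOME C. is_core m L D C \<and> 2 * k \<le> card C)"
  define E where "E = (\<lambda>(L, D). cyl n (vpairs m \<times> {0}) (cell r L D))"
  define A where "A i = cyl n (coords n i) (window r i)" for i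
  define p where "p i = measure (model n) (A i)" for i
  define \<mu> where "\<mu> d = (\<Sum>i\<in>configs m n (K d). p i)" for d
  define F where "F d = {x \<in> E d. real (card {i \<in> configs m n (K d). x \<in> A i}) < \<mu> d / 2}" for d
  let ?\<epsilon> = "4 * (1 / \<mu>\<^sub>0 + 1 / h ^ 4 - 1)"
  have K: "is_core m (fst d) (snd d) (K d)" "2 * k \<le> card (K d)" if "d \<in> \<D>" for d
  proof -
    have "\<exists>C. is_core m (fst d) (snd d) C \<and> 2 * k \<le> card C"
      using that by (auto simp: \<D>_def)
    from someI_ex[OF this] show "is_core m (fst d) (snd d) (K d)" "2 * k \<le> card (K d)"
      unfolding K_def split_beta by blast+
  qed
  have K_sub: "K d \<subseteq> {..<m}" "finite (K d)" if "d \<in> \<D>" for d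
    using K(1)[OF that] finite_subset by (auto simp: is_core_def)
  have V: "vpairs m \<times> {0} \<subseteq> vpairs n \<times> (UNIV :: nat set)" "finite (vpairs m \<times> {0 :: nat})"
    using vpairs_mono[OF m(1)] finite_vpairs by auto
  have E_sets: "E d \<in> sets (model n)" for d
    unfolding E_def using V by (cases d) (auto intro!: sets_cyl sets_cell)
  have E_eq: "E d = {x \<in> space (model n). low m r x = fst d \<and> mid m r x = snd d}" if "d \<in> \<D>" for d
    unfolding E_def split_beta by (rule cells[symmetric]) (use that r(1) in \<open>auto simp: \<D>_def\<close>)
  have \<D>_fin: "finite \<D>"
    by (rule finite_subset[of _ "Pow (vpairs m) \<times> Pow (vpairs m)"]) (auto simp: \<D>_def finite_vpairs)
  have \<mu>_ge: "\<mu>\<^sub>0 \<le> \<mu> d" if "d \<in> \<D>" for d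
  proof -
    have "\<mu>\<^sub>0 \<le> real (card (configs m n (K d))) * ((r / 2) ^ 4 * h ^ (2 * n))"
      using K_sub(1)[OF that] K(2)[OF that] by (rule \<mu>\<^sub>0)
    also have "\<dots> = (\<Sum>i\<in>configs m n (K d). (r / 2) ^ 4 * h ^ (2 * n))"
      by simp
    also have "\<dots> \<le> \<mu> d"
      unfolding \<mu>_def p_def A_def h using K_sub(1)[OF that] m(1) r by (intro sum_mono config_prob_ge)
    finally show ?thesis .
  qed
  have F: "F d \<in> sets (model n)" "measure (model n) (F d) \<le> measure (model n) (E d) * ?\<epsilon>" if d: "d \<in> \<D>" for d
  proof -
    have A_sets: "A i \<in> sets (model n)" if "i \<in> configs m n (K d)" for i
      unfolding A_def using coords_subset[OF that K_sub(1)[OF d] m(1)]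
      by (intro sets_cyl finite_coords sets_window)
    have EA: "measure (model n) (E d \<inter> A i) = measure (model n) (E d) * p i" if i: "i \<in> configs m n (K d)" for i
      unfolding A_def p_def E_def split_beta
      using V coords_subset[OF i K_sub(1)[OF d] m(1)] coords_outside[OF i K_sub(1)[OF d] m(1)]
      by (intro measure_cyl_Int finite_coords sets_window sets_cell)
    have EAA: "measure (model n) (E d \<inter> (A i \<inter> A j)) \<le> measure (model n) (E d) * (1 / h ^ 4 * p i * p j)"
      if "i \<in> configs m n (K d)" "j \<in> configs m n (K d)" "i \<noteq> j" for i j
      unfolding A_def p_def h
      using that K_sub(1)[OF d] m(1) r(1) h_pos
      by (intro config_pair_prob_le[where L = "fst d" and L' = "snd d"]) (auto simp: h E_def split_beta)
    have \<mu>_pos: "0 < \<mu> d"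
      using \<mu>_ge[OF d] \<open>0 < \<mu>\<^sub>0\<close> by simp
    note moment = M.few_events_prob_le[OF finite_configs[OF K_sub(2)[OF d]] E_sets A_sets _ _ EA EAA \<mu>_def \<mu>_pos]
    show "F d \<in> sets (model n)"
      unfolding F_def by (rule moment(1)) (use h_pos in \<open>auto simp: p_def\<close>)
    have "measure (model n) (F d) \<le> measure (model n) (E d) * (4 * (1 / \<mu> d + 1 / h ^ 4 - 1))"
      unfolding F_def by (rule moment(2)) (use h_pos in \<open>auto simp: p_def\<close>)
    also have "\<dots> \<le> measure (model n) (E d) * ?\<epsilon>"
      using \<mu>_ge[OF d] \<open>0 < \<mu>\<^sub>0\<close> by (intro mult_left_mono) (auto simp: frac_le)
    finally show "measure (model n) (F d) \<le> measure (model n) (E d) * ?\<epsilon>" .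
  qed
  define B1 where "B1 = {x \<in> space (model n). \<not> expanding m k {..r} x}"
  define B2 where "B2 = {x \<in> space (model n). \<not> expanding m k {r<..2 * r} x}"
  have "r / 2 \<le> prob {0<..r}"
    using lower[of 0 r] r by simp
  also have "\<dots> \<le> prob {..r}"
    by (intro finite_measure_mono) auto
  finally have W1: "r / 2 \<le> prob {..r}" .
  have W2: "r / 2 \<le> prob {r<..2 * r}"
    using lower[of r "2 * r"] r by simp
  have B1: "B1 \<in> sets (model n)" "measure (model n) B1 \<le> 4 ^ m * exp (- (r / 2) * (real k)\<^sup>2)"
    unfolding B1_def using sets_not_expanding[OF m(1) _ W1] prob_not_expanding_le[OF m(1) _ W1, of k] r
    by simp_all
  have B2: "B2 \<in> sets (model n)" "measure (model n) B2 \<le> 4 ^ m * exp (- (r / 2) * (real k)\<^sup>2)"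
    unfolding B2_def using sets_not_expanding[OF m(1) _ W2] prob_not_expanding_le[OF m(1) _ W2, of k] r
    by simp_all
  define B3 where "B3 = (\<Union>d\<in>\<D>. F d)"
  have B3_sets: "B3 \<in> sets (model n)"
    unfolding B3_def using \<D>_fin F(1) by (rule sets.finite_UN)
  have "measure (model n) B3 \<le> (\<Sum>d\<in>\<D>. measure (model n) (F d))"
    unfolding B3_def using \<D>_fin F(1) by (intro M.finite_measure_subadditive_finite) auto
  also have "\<dots> \<le> (\<Sum>d\<in>\<D>. measure (model n) (E d) * ?\<epsilon>)"
    using F(2) by (rule sum_mono)
  also have "\<dots> = measure (model n) (\<Union>d\<in>\<D>. E d) * ?\<epsilon>"
  proof -
    have "disjoint_family_on E \<D>"
      unfolding disjoint_family_on_def by (auto simp: E_eq prod_eq_iff)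
    then have "measure (model n) (\<Union>d\<in>\<D>. E d) = (\<Sum>d\<in>\<D>. measure (model n) (E d))"
      using \<D>_fin E_sets by (intro M.finite_measure_finite_Union) auto
    then show ?thesis
      by (simp add: sum_distrib_right)
  qed
  also have "\<dots> \<le> 1 * ?\<epsilon>"
  proof (intro mult_right_mono)
    have "1 \<le> 1 / h ^ 4" "0 \<le> 1 / \<mu>\<^sub>0"
      using h_pos \<open>0 < \<mu>\<^sub>0\<close> by (simp_all add: power_le_one)
    then have "0 \<le> 1 / \<mu>\<^sub>0 + 1 / h ^ 4 - 1"
      by linarith
    then show "0 \<le> ?\<epsilon>"
      by (rule mult_nonneg_nonneg[rotated]) simp
  qed simp
  finally have B3: "measure (model n) B3 \<le> ?\<epsilon>"
    by simp
  show ?thesis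
  proof (rule that[of "B1 \<union> B2 \<union> B3"])
    show "B1 \<union> B2 \<union> B3 \<in> sets (model n)"
      using B1 B2 B3_sets by auto
    have "measure (model n) (B1 \<union> B2 \<union> B3) \<le> measure (model n) B1 + measure (model n) B2 + measure (model n) B3"
      using B1(1) B2(1) B3_sets
      by (intro order_trans[OF measure_Un_le] add_mono) auto
    then show "measure (model n) (B1 \<union> B2 \<union> B3) \<le> 2 * 4 ^ m * exp (- (r / 2) * (real k)\<^sup>2) + ?\<epsilon>"
      using B1(2) B2(2) B3 by simp
    fix x assume x: "x \<in> space (model n) - (B1 \<union> B2 \<union> B3)"
    define d where "d = (low m r x, mid m r x)"
    obtain C where "is_core m (low m r x) (mid m r x) C" "2 * k \<le> card C"
      using core_exists[of m k r x] x m by (auto simp: B1_def B2_def)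
    then have d: "d \<in> \<D>"
      by (auto simp: \<D>_def d_def low_def mid_def)
    have "x \<in> E d"
      using x E_eq[OF d] by (auto simp: d_def)
    moreover have "x \<notin> F d"
      using x d by (auto simp: B3_def)
    ultimately have "\<mu> d / 2 \<le> real (card {i \<in> configs m n (K d). x \<in> A i})"
      by (simp add: F_def)
    moreover have "x \<in> A i \<longleftrightarrow> is_config n r i x" for i
      using x by (simp add: A_def cyl_def is_config_def)
    ultimately show "\<exists>C. is_core m (low m r x) (mid m r x) C \<and>
        \<mu>\<^sub>0 / 2 \<le> real (card {i \<in> configs m n C. is_config n r i x})"
      using K(1)[OF d] \<mu>_ge[OF d] by (intro exI[of _ "K d"]) (auto simp: d_def)
  qed
qed

end

section \<open>Asymptotics\<close>

text \<open>From \<open>ln (1 - y) \<ge> - y - 2 * y\<^sup>2\<close>, where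
  \<open>y \<le> 1 / 2\<close> absorbs the quadratic term.\<close>

lemma one_minus_power_ge_exp:
  fixes y :: real
  assumes "0 \<le> y" "y \<le> 1 / 2"
  shows "exp (- 2 * y * real k) \<le> (1 - y) ^ k"
proof -
  have "- 2 * y \<le> - y - 2 * y\<^sup>2"
    using mult_left_mono[OF assms(2), of y] assms(1) by (simp add: power2_eq_square)
  also have "\<dots> \<le> ln (1 - y)"
    using ln_one_minus_pos_lower_bound[OF assms] by simp
  finally have "exp (- 2 * y) \<le> exp (ln (1 - y))"
    by simp
  also have "\<dots> = 1 - y"
    using assms by simp
  finally have "exp (- 2 * y) ^ k \<le> (1 - y) ^ k"
    by (intro power_mono) auto
  then show ?thesis
    by (simp add: exp_of_nat_mult[symmetric] mult.commute)
qed

text \<open>There are at least \<open>n\<^sup>5 / 8192\<close> candidate tuples, each of which is a configuration with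
  probability at least \<open>(256 / n)\<^sup>4 exp (- 10240)\<close>; \<open>\<kappa> n\<close> is half of the resulting bound on the
  expected number.\<close>
definition \<kappa> :: real where
  "\<kappa> = 262144 * exp (- 10240)"

lemma \<kappa>_pos: "0 < \<kappa>"
  by (simp add: \<kappa>_def)

text \<open>With \<open>n \<le> 16 * k\<close>, the constant \<open>512 = 2 * 16\<^sup>2\<close>
  gives \<open>rad n / 2 * k\<^sup>2 \<ge> n\<close>. The non-expansion probability is then of order
  \<open>(2 / e) ^ n\<close>.\<close>

definition rad :: "nat \<Rightarrow> real" where
  "rad n = 512 / real n"

text \<open>The first term bounds the failure of expansion, using
  \<open>4 ^ (n div 2) \<le> 2 ^ n\<close>. The second is the Chebyshev error with mean at least
  \<open>2 * \<kappa> * n\<close>, where \<open>2560 / n\<close> is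
  \<open>5 * rad n\<close>.\<close>

definition err :: "nat \<Rightarrow> real" where
  "err n = 2 * 2 ^ n * exp (- real n) +
     4 * (1 / (2 * \<kappa> * real n) + 1 / (1 - 2560 / real n) ^ 4 - 1)"

lemma err_tendsto_0: "err \<longlonglongrightarrow> 0"
proof -
  have "exp (ln 2) < exp (1 :: real)"
    using ln_2_less_1 by (simp only: exp_less_mono)
  then have "2 * exp (- 1) < (1 :: real)"
    by (simp add: exp_minus field_simps)
  then have "(\<lambda>n. 2 * (2 * exp (- 1 :: real)) ^ n) \<longlonglongrightarrow> 2 * 0"
    by (intro tendsto_mult_left LIMSEQ_power_zero) simp
  then have "(\<lambda>n. 2 * 2 ^ n * exp (- real n)) \<longlonglongrightarrow> 0"
    by (simp add: power_mult_distrib mult.assoc flip: exp_of_nat_mult)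
  moreover have "(\<lambda>n. 4 * (1 / (2 * \<kappa> * real n) + 1 / (1 - 2560 / real n) ^ 4 - 1)) \<longlonglongrightarrow> 0"
    using \<kappa>_pos by real_asymp
  ultimately show ?thesis
    unfolding err_def[abs_def] by (rule tendsto_add_zero)
qed

section \<open>Substituting the parameters and passing to the limit\<close>

context edge_law
begin

lemma core_with_many_configs:
  assumes n: "8192 \<le> n"
  defines "m \<equiv> n div 2" and "r \<equiv> rad n"
  obtains B where "B \<in> sets (model n)" "measure (model n) B \<le> err n"
    "\<And>x. x \<in> space (model n) - B \<Longrightarrow> \<exists>C. is_core m (low m r x) (mid m r x) C \<and>
      \<kappa> * real n \<le> real (card {i \<in> configs m n C. is_config n r i x})"
proof -
  define k where "k = m div 4"
  let ?h = "prob {5 * r<..}"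
  have k: "0 < k" "4 * k \<le> m" "n \<le> 16 * k" and m: "m \<le> n" "2 * m \<le> n"
    using n by (auto simp: k_def m_def)
  \<comment> \<open>The threshold \<open>8192 = 16 * 512\<close> is what the middle inequality
    needs.\<close>
  have r: "0 < r" "16 * r \<le> 1" "5 * r = 2560 / real n"
    using n by (auto simp: r_def rad_def field_simps)
  have "1 - 5 * r \<le> ?h"
    using expensive_prob[of r] r(1) by simp
  then have h: "1 - 2560 / real n \<le> ?h" "0 < 1 - 2560 / real n"
    using n by (simp_all only: r(3)) (simp add: field_simps)
  have "exp (- 2 * (2560 / real n) * real (2 * n)) \<le> (1 - 2560 / real n) ^ (2 * n)"
    using n by (intro one_minus_power_ge_exp) (auto simp: field_simps)
  also have "\<dots> \<le> ?h ^ (2 * n)"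
    using h by (intro power_mono) auto
  also have "- 2 * (2560 / real n) * real (2 * n) = - 10240"
    using n by simp
  finally have h_power: "exp (- 10240) \<le> ?h ^ (2 * n)" .
  have \<mu>: "2 * \<kappa> * real n \<le> real (card (configs m n C)) * ((r / 2) ^ 4 * ?h ^ (2 * n))"
    if C: "C \<subseteq> {..<m}" "2 * k \<le> card C" for C
  proof -
    have fin: "finite C"
      using C(1) finite_subset by blast
    have bounds: "real n / 2 \<le> real (n - m)" "real n / 4 \<le> real (n - m - 1)"
      "real n / 8 \<le> real (card C)" "real n / 16 \<le> real (card C - 1)"
      using m n k C(2) by linarith+
    \<comment> \<open>One factor for each of \<open>a\<close>, \<open>b\<close>, \<open>u\<close>,
      \<open>v\<close>, \<open>w\<close>; the weaker ones for \<open>b\<close> and \<open>w\<close>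
      allow for the excluded equal choice.\<close>
    have "real n ^ 5 / 8192 = (real n / 2) * (real n / 4) * (real n / 8) * (real n / 8) * (real n / 16)"
      by (simp add: power_def numeral_eq_Suc)
    also have "\<dots> \<le> real (n - m) * real (n - m - 1) * real (card C) * real (card C) * real (card C - 1)"
      using bounds by (intro mult_mono) auto
    also have "\<dots> = real (card (configs m n C))"
      by (simp add: card_configs[OF fin])
    finally have "real n ^ 5 / 8192 * ((r / 2) ^ 4 * exp (- 10240)) \<le>
      real (card (configs m n C)) * ((r / 2) ^ 4 * ?h ^ (2 * n))"
      using h_power r by (intro mult_mono) auto
    moreover have "real n ^ 5 / 8192 * ((r / 2) ^ 4 * exp (- 10240)) = 2 * \<kappa> * real n"
    proof -
      have "(r / 2) ^ 4 = 4294967296 / real n ^ 4"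
        by (simp add: r_def rad_def power_divide)
      moreover have "real n ^ 5 = real n ^ 4 * real n"
        using power_Suc2[of "real n" 4] by simp
      ultimately show ?thesis
        using n by (simp add: \<kappa>_def)
    qed
    ultimately show ?thesis
      by simp
  qed
  have "8 * r \<le> 1"
    using r by simp
  moreover have "0 < 2 * \<kappa> * real n"
    using \<kappa>_pos n by simp
  ultimately obtain B where B: "B \<in> sets (model n)"
    "measure (model n) B \<le> 2 * 4 ^ m * exp (- (r / 2) * (real k)\<^sup>2) + 4 * (1 / (2 * \<kappa> * real n) + 1 / ?h ^ 4 - 1)"
    "\<And>x. x \<in> space (model n) - B \<Longrightarrow> \<exists>C. is_core m (low m r x) (mid m r x) C \<and>
      2 * \<kappa> * real n / 2 \<le> real (card {i \<in> configs m n C. is_config n r i x})"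
    using core_with_configs[OF m(1) k(1,2) r(1) _ refl _ \<mu>] by blast
  have "measure (model n) B \<le> err n"
  proof -
    have "(4 :: real) ^ m = 2 ^ (2 * m)"
      by (simp add: power_mult)
    also have "\<dots> \<le> 2 ^ n"
      using m by (intro power_increasing) auto
    finally have pow: "(4 :: real) ^ m \<le> 2 ^ n" .
    have "(real n)\<^sup>2 \<le> (16 * real k)\<^sup>2"
      using k(3) by (intro power_mono) linarith+
    then have "real n \<le> r / 2 * (real k)\<^sup>2"
      using n by (simp add: r_def rad_def field_simps power2_eq_square)
    then have "exp (- (r / 2) * (real k)\<^sup>2) \<le> exp (- real n)"
      by simp
    then have "2 * 4 ^ m * exp (- (r / 2) * (real k)\<^sup>2) \<le> 2 * 2 ^ n * exp (- real n)"
      using pow by (intro mult_mono) auto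
    moreover have "1 / ?h ^ 4 \<le> 1 / (1 - 2560 / real n) ^ 4"
      using h by (intro divide_left_mono power_mono mult_pos_pos) auto
    ultimately show ?thesis
      using B(2) unfolding err_def by argo
  qed
  then show ?thesis
    using B(1,3) by (intro that[of B]) auto
qed

lemma AE_model_nonneg: "AE x in model n. \<forall>t\<in>vpairs n \<times> UNIV. 0 \<le> x t"
proof -
  interpret PQ: product_prob_space "\<lambda>_. Q" "vpairs n \<times> (UNIV :: nat set)"
    by unfold_locales
  have "prob {..0} = 0"
    using upper[of 0] measure_nonneg[of Q "{..0}"] by simp
  then have "{..0} \<in> null_sets Q"
    by (auto simp: null_sets_def emeasure_eq_measure)
  then have "AE y in Q. 0 \<le> y"
    by (rule AE_I'[of "{..0}"]) auto
  then show ?thesis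
    unfolding model_def
    by (subst AE_ball_countable) (auto intro!: PQ.AE_component countable_SIGMA countable_finite finite_vpairs)
qed

text \<open>Isolates the probability: for each model only measurability and a deterministic
  implication for nonnegative costs remain to be checked.\<close>

lemma measure_tendsto_1:
  assumes G: "\<And>n. G n \<in> sets (model n)"
    and imp: "\<And>n x C. 8192 \<le> n \<Longrightarrow> x \<in> space (model n) \<Longrightarrow> \<forall>t\<in>vpairs n \<times> UNIV. 0 \<le> x t \<Longrightarrow>
      is_core (n div 2) (low (n div 2) (rad n) x) (mid (n div 2) (rad n) x) C \<Longrightarrow>
      \<kappa> * real n \<le> real (card {i \<in> configs (n div 2) n C. is_config n (rad n) i x}) \<Longrightarrow> x \<in> G n"
  shows "(\<lambda>n. measure (model n) (G n)) \<longlonglongrightarrow> 1"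
proof (rule tendsto_sandwich)
  show "(\<lambda>n. 1 - err n) \<longlonglongrightarrow> 1"
    using tendsto_diff[OF tendsto_const err_tendsto_0, of 1] by simp
  show "\<forall>\<^sub>F n in sequentially. 1 - err n \<le> measure (model n) (G n)"
  proof (rule eventually_sequentiallyI[of 8192])
    fix n :: nat assume n: "8192 \<le> n"
    interpret M: prob_space "model n"
      by (rule prob_space_model)
    obtain B where B: "B \<in> sets (model n)" "measure (model n) B \<le> err n"
      "\<And>x. x \<in> space (model n) - B \<Longrightarrow>
        \<exists>C. is_core (n div 2) (low (n div 2) (rad n) x) (mid (n div 2) (rad n) x) C \<and>
        \<kappa> * real n \<le> real (card {i \<in> configs (n div 2) n C. is_config n (rad n) i x})"
      using core_with_many_configs[OF n] by blast
    have "1 - err n \<le> measure (model n) (space (model n) - B)"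
      using B by (simp add: M.prob_compl)
    also have "\<dots> \<le> measure (model n) (G n)"
    proof (rule M.finite_measure_mono_AE)
      show "AE x in model n. x \<in> space (model n) - B \<longrightarrow> x \<in> G n"
        using AE_model_nonneg[of n]
      proof eventually_elim
        case (elim x)
        then show ?case
          using B(3)[of x] imp[OF n] by blast
      qed
    qed (rule G)
    finally show "1 - err n \<le> measure (model n) (G n)" .
  qed
  show "\<forall>\<^sub>F n in sequentially. measure (model n) (G n) \<le> 1"
    by (intro always_eventually allI prob_space.prob_le_1 prob_space_model)
qed simp

end

section \<open>Transfer to the three models\<close>

lemma good_event_mono: "good_event n ends c E \<delta> \<Longrightarrow> \<delta>' \<le> \<delta> \<Longrightarrow> good_event n ends c E \<delta>'"
  unfolding good_event_def by (meson add_left_mono order_trans)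

text \<open>Linearly many configurations, each saving \<open>512 / n\<close>, give a gap independent
  of \<open>n\<close>; this is the final \<open>\<delta>\<close>.\<close>

lemma \<kappa>_rad: "0 < n \<Longrightarrow> \<kappa> * real n \<le> real N \<Longrightarrow> 512 * \<kappa> \<le> real N * rad n"
  by (simp add: rad_def field_simps)

lemma countable_vpairs: "countable (vpairs n)" "countable (vpairs n \<times> (UNIV :: nat set))"
  by (auto intro!: countable_SIGMA countable_finite finite_vpairs)

context edge_law
begin

text \<open>Restricting to the coordinates \<open>(p, 0)\<close> pushes \<open>model n\<close>
  forward to the product measure over pairs, so the limit can be computed in
  \<open>model n\<close>.\<close>

lemma simple_model_tendsto:
  "(\<lambda>n. measure (PiM (vpairs n) (\<lambda>_. Q))
     {x \<in> space (PiM (vpairs n) (\<lambda>_. Q)). good_event n id x (vpairs n) (512 * \<kappa>)}) \<longlonglongrightarrow> 1"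
proof -
  let ?P = "\<lambda>n. PiM (vpairs n) (\<lambda>_. Q)"
  let ?T = "\<lambda>n x. \<lambda>p\<in>vpairs n. x (p, 0 :: nat)"
  let ?S = "\<lambda>n. {x \<in> space (?P n). good_event n id x (vpairs n) (512 * \<kappa>)}"
  have S: "?S n \<in> sets (?P n)" for n
  proof (rule sets_good_event[OF countable_vpairs(1)])
    fix p assume "p \<in> vpairs n"
    then show "(\<lambda>x. x p) \<in> borel_measurable (?P n)"
      using measurable_component_singleton[of p "vpairs n" "\<lambda>_. Q"] measurable_cong_sets[OF refl sets_Q] by blast
  qed
  have distr: "distr (model n) (?P n) (?T n) = ?P n" for n
    unfolding model_def
    by (rule distr_PiM_reindex[of "vpairs n \<times> UNIV" "\<lambda>_. Q" "\<lambda>p. (p, 0)" "vpairs n"])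
      (auto simp: inj_on_def prob_space_axioms)
  have T: "?T n \<in> measurable (model n) (?P n)" for n
    unfolding model_def by (intro measurable_restrict measurable_component_singleton) auto
  have "measure (?P n) (?S n) = measure (model n) (?T n -` ?S n \<inter> space (model n))" for n
    using measure_distr[OF T S] unfolding distr .
  moreover have "(\<lambda>n. measure (model n) (?T n -` ?S n \<inter> space (model n))) \<longlonglongrightarrow> 1"
  proof (rule measure_tendsto_1)
    show "?T n -` ?S n \<inter> space (model n) \<in> sets (model n)" for n
      using T S by (rule measurable_sets)
    fix n x C
    assume n: "8192 \<le> n" and x: "x \<in> space (model n)" "\<forall>t\<in>vpairs n \<times> UNIV. 0 \<le> x t"
      and core: "is_core (n div 2) (low (n div 2) (rad n) x) (mid (n div 2) (rad n) x) C"
      and card: "\<kappa> * real n \<le> real (card {i \<in> configs (n div 2) n C. is_config n (rad n) i x})"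
    have "good_event n id (?T n x) (vpairs n)
        (real (card {i \<in> configs (n div 2) n C. is_config n (rad n) i x}) * rad n)"
      by (rule good_event_of_core[OF _ _ core, where g = id]) (use x n in \<open>auto simp: rad_def\<close>)
    then have "good_event n id (?T n x) (vpairs n) (512 * \<kappa>)"
      by (rule good_event_mono) (use n card in \<open>simp add: \<kappa>_rad\<close>)
    then show "x \<in> ?T n -` ?S n \<inter> space (model n)"
      using x(1) measurable_space[OF T x(1)] by simp
  qed
  ultimately show ?thesis
    by simp
qed

lemma poisson_model_tendsto:
  "(\<lambda>n. measure (model n)
     {x \<in> space (model n). good_event n fst (pois_cost x) (vpairs n \<times> UNIV) (512 * \<kappa>)}) \<longlonglongrightarrow> 1"
proof (rule measure_tendsto_1)
  show "{x \<in> space (model n). good_event n fst (pois_cost x) (vpairs n \<times> UNIV) (512 * \<kappa>)} \<in> sets (model n)" for n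
  proof (rule sets_good_event[OF countable_vpairs(2)])
    fix e assume e: "e \<in> vpairs n \<times> (UNIV :: nat set)"
    have "(\<lambda>x. x (fst e, k)) \<in> measurable (model n) Q" for k
      unfolding model_def by (rule measurable_component_singleton) (use e in auto)
    then have "(\<lambda>x. x (fst e, k)) \<in> borel_measurable (model n)" for k
      using measurable_cong_sets[OF refl sets_Q] by blast
    then show "(\<lambda>x. pois_cost x e) \<in> borel_measurable (model n)"
      unfolding pois_cost_def by (intro borel_measurable_sum)
  qed
  fix n x C
  assume n: "8192 \<le> n" and x: "x \<in> space (model n)" "\<forall>t\<in>vpairs n \<times> UNIV. 0 \<le> x t"
    and core: "is_core (n div 2) (low (n div 2) (rad n) x) (mid (n div 2) (rad n) x) C"
    and card: "\<kappa> * real n \<le> real (card {i \<in> configs (n div 2) n C. is_config n (rad n) i x})"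
  have nonneg: "0 \<le> x (p, k)" if "p \<in> vpairs n" for p k
    using x(2) that by auto
  have "good_event n fst (pois_cost x) (vpairs n \<times> UNIV)
      (real (card {i \<in> configs (n div 2) n C. is_config n (rad n) i x}) * rad n)"
  proof (rule good_event_of_core[OF _ _ core, where g = "\<lambda>p. (p, 0)"])
    fix e assume e: "e \<in> vpairs n \<times> (UNIV :: nat set)"
    then show "fst e \<in> vpairs n"
      by auto
    show "0 \<le> pois_cost x e"
      unfolding pois_cost_def using e nonneg by (intro sum_nonneg) auto
    \<comment> \<open>A later arrival on a pair is a sum of nonnegative terms that includes the
      first two interarrival times.\<close>
    assume "e \<noteq> (fst e, 0)"
    then have "1 \<le> snd e"
      by (cases e) auto
    then have "x (fst e, k) \<le> pois_cost x e" if "k \<le> 1" for k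
      unfolding pois_cost_def using that e nonneg by (intro member_le_sum) auto
    then show "x (fst e, 0) \<le> pois_cost x e \<and> x (fst e, 1) \<le> pois_cost x e"
      by simp
  qed (use n in \<open>auto simp: rad_def pois_cost_def\<close>)
  then have "good_event n fst (pois_cost x) (vpairs n \<times> UNIV) (512 * \<kappa>)"
    by (rule good_event_mono) (use n card in \<open>simp add: \<kappa>_rad\<close>)
  then show "x \<in> {x \<in> space (model n). good_event n fst (pois_cost x) (vpairs n \<times> UNIV) (512 * \<kappa>)}"
    using x(1) by simp
qed

end

text \<open>The upper bound is \<open>1 - exp (- t) \<le> t\<close>. For the lower one,
  \<open>exp (- t) \<ge> 1 - t \<ge> 1 / 2\<close> on the range considered.\<close>

lemma edge_law_exp1: "edge_law exp1"
proof -
  interpret prob_space exp1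
    unfolding exp1_def by (rule prob_space_exponential_density) simp
  have sets [simp]: "sets exp1 = sets borel"
    by (simp add: exp1_def)
  have space [simp]: "space exp1 = UNIV"
    by (simp add: exp1_def)
  have "distributed exp1 lborel (\<lambda>x. x) (exponential_density 1)"
    unfolding distributed_def by (auto simp: exp1_def distr_id2 measurable_ident_sets)
  then have cdf: "prob {..t} = 1 - exp (- t)" if "0 \<le> t" for t
    using exponential_distributedD_le[of "\<lambda>x. x" 1 t] that by (simp add: atMost_def)
  show ?thesis
  proof
    show "sets exp1 = sets borel"
      by simp
    show "prob {..t} \<le> t" if "0 \<le> t" for t
      using cdf[OF that] exp_ge_add_one_self[of "- t"] by simp
    show "(t - s) / 2 \<le> prob {s<..t}" if st: "0 \<le> s" "s \<le> t" "t \<le> 1 / 2" for s t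
    proof -
      have "{s<..t} = {..t} - {..s}"
        by auto
      also have "prob \<dots> = prob {..t} - prob {..s}"
        using st by (intro finite_measure_Diff) auto
      also have "\<dots> = exp (- t) * (exp (t - s) - 1)"
        using st cdf by (simp add: algebra_simps flip: exp_add)
      finally have eq: "prob {s<..t} = exp (- t) * (exp (t - s) - 1)" .
      have "1 / 2 \<le> exp (- t)" "t - s \<le> exp (t - s) - 1"
        using st exp_ge_add_one_self[of "- t"] exp_ge_add_one_self[of "t - s"] by linarith+
      then have "1 / 2 * (t - s) \<le> exp (- t) * (exp (t - s) - 1)"
        using st by (intro mult_mono) auto
      then show ?thesis
        by (simp add: eq)
    qed
  qed
qed

lemma edge_law_unif01: "edge_law unif01"
proof -
  interpret prob_space unif01
    unfolding unif01_def by (rule prob_space_uniform_measure) auto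
  have law: "prob A = measure lborel ({0<..<1} \<inter> A)" if "A \<in> sets borel" for A
    unfolding unif01_def using that by (subst measure_uniform_measure) auto
  show ?thesis
  proof
    show "sets unif01 = sets borel"
      by (simp add: unif01_def)
    show "prob {..t} \<le> t" if "0 \<le> t" for t
    proof -
      have "measure lborel ({0<..<1} \<inter> {..t}) \<le> measure lborel {0..t}"
        using that by (intro measure_mono_fmeasurable) (auto intro: fmeasurable_compact)
      then show ?thesis
        using that by (simp add: law)
    qed
    show "(t - s) / 2 \<le> prob {s<..t}" if st: "0 \<le> s" "s \<le> t" "t \<le> 1 / 2" for s t
    proof -
      have "{0<..<1} \<inter> {s<..t} = {s<..t}"
        using st by auto
      then show ?thesis
        using st by (simp add: law)
    qed
  qed
qed

theorem theorem8p3: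
  shows "\<exists>\<delta>>0.
    (\<lambda>n. measure (pois_model n)
        {x \<in> space (pois_model n). good_event n fst (pois_cost x) (vpairs n \<times> UNIV) \<delta>})
      \<longlonglongrightarrow> 1 \<and>
    (\<lambda>n. measure (exp_model n)
        {x \<in> space (exp_model n). good_event n id x (vpairs n) \<delta>})
      \<longlonglongrightarrow> 1 \<and>
    (\<lambda>n. measure (unif_model n)
        {x \<in> space (unif_model n). good_event n id x (vpairs n) \<delta>})
      \<longlonglongrightarrow> 1"
proof -
  interpret exp: edge_law exp1
    by (rule edge_law_exp1)
  interpret unif: edge_law unif01
    by (rule edge_law_unif01)
  show ?thesis
    using exp.poisson_model_tendsto exp.simple_model_tendsto unif.simple_model_tendsto \<kappa>_pos
    unfolding exp.model_def pois_model_def exp_model_def unif_model_def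
    by (intro exI[of _ "512 * \<kappa>"]) simp
qed

end
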